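(* Let $f(X)=\sum_{m=0}^\infty a_mX^m$ be either a polynomial with coefficients in an arbitrary field $\mathbb{K}$, or a power series with coefficients in $\mathbb{K}$, where in the latter case $\mathbb{K}$ is supposed to be a complete valued field with respect to a non-trivial absolute value. Let $M\in\Omega_{f,\mathbb{K}}$ and let $\lambda$ be an eigenvalue of $M$ (so $\lambda$ belongs to the splitting field $\mathbb{F}$ of the minimal polynomial of $M$). Then $f(M)\in M_n(\mathbb{K})$ and $\Phi_k(\lambda)\in\mathbb{F}$ for every $k\ge0$ (in the power series case, the series $f(M)$ and $\Phi_k(\lambda)$ converge). Furthermore $$f(M)=\sum_{i=1}^r\sum_{j=1}^{\rho_i}\Big[\sum_{k=0}^{\eta_i-1}\Phi_k(\lambda_{ij})(M-\lambda_{ij}I_n)^k\Big]C_{ij}(M).$$ The semisimple and the nilpotent parts of $f(M)$ are respectively $$S(f(M))=\sum_{i=1}^r\sum_{j=1}^{\rho_i}f(\lambda_{ij})C_{ij}(M),$$ $$N(f(M))=\sum_{i=1}^r\sum_{j=1}^{\rho_i}\sum_{k=1}^{\eta_i}\Phi_k(\lambda_{ij})(M-\lambda_{ij}I_n)^kC_{ij}(M).$$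
   Context: $\overline{\mathbb{K}}$ is the algebraic closure of $\mathbb{K}$. A square matrix is semisimple if it is diagonalizable over $\overline{\mathbb{K}}$. The semisimple part $S(A)$ and nilpotent part $N(A)$ of $A\in M_n(\mathbb{K})$ are the unique matrices over $\overline{\mathbb{K}}$, respectively semisimple and nilpotent, which commute and satisfy $A=S(A)+N(A)$. Matrix notation: let $m(X)=m_1(X)^{\mu_1}\cdots m_r(X)^{\mu_r}$ be the minimal polynomial of $M\in M_n(\mathbb{K})$ over $\mathbb{K}$, with $\mu_i>0$ and $m_1,\dots,m_r$ mutually distinct (monic) irreducible polynomials in $\mathbb{K}[X]$. If $0$ is an eigenvalue of $M$, the factors are ordered so that $m_r(X)=X$. $\mathbb{F}\subseteq\overline{\mathbb{K}}$ is the splitting field of $m(X)$ over $\mathbb{K}$. For each $i$, $\lambda_{i1},\dots,\lambda_{i\rho_i}$ are the distinct roots of $m_i(X)$ in $\mathbb{F}$. One has $m(X)=\prod_{i=1}^r\prod_{j=1}^{\rho_i}(X-\lambda_{ij})^{\eta_i}$ for suitable integers $\eta_i\ge\mu_i$ (independent of $j$). Put $G_{ij}(X)=m(X)/(X-\lambda_{ij})^{\eta_i}$. There is a unique family of polynomials $B_{ij}(X)\in\mathbb{K}(\lambda_{i1},\dots,\lambda_{i\rho_i})[X]$ with $\deg B_{ij}<\eta_i$ and $\sum_{i=1}^r\sum_{j=1}^{\rho_i}B_{ij}(X)G_{ij}(X)=1$; put $C_{ij}(X)=B_{ij}(X)G_{ij}(X)$. Valued fields: an absolute value on $\mathbb{K}$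 is a function $|\cdot|:\mathbb{K}\to\mathbb{R}$ with $|x|\ge0$, $|x|=0$ iff $x=0$, $|x+y|\le|x|+|y|$, $|xy|=|x||y|$; it is trivial if $|x|=1$ for all $x\neq0$. When $\mathbb{K}$ is complete with respect to a non-trivial absolute value, the absolute value extends uniquely to $\overline{\mathbb{K}}$ (still denoted $|\cdot|$); convergence in $\mathbb{F}$ is with respect to it and convergence in $M_n(\mathbb{K})$ is with respect to the product topology. The spectral radius $\rho(A)$ of a matrix $A$ is the maximum of $|\lambda|$ over the eigenvalues $\lambda\in\overline{\mathbb{K}}$ of $A$. For a power series $f$, the radius of convergence $R_f\in\mathbb{R}\cup\{+\infty\}$ is the supremum of the real numbers $t\ge0$ such that the sequence $|a_m|t^m$ is bounded above, and $\Omega_{f,\mathbb{K}}=\{A\in M_n(\mathbb{K}) : \rho(A)<R_f\}$. If $f$ is a polynomial (over any field $\mathbb{K}$), one sets $R_f=+\infty$ and $\Omega_{f,\mathbb{K}}=M_n(\mathbb{K})$. For $k\ge0$, $\Phi_k(X)=\sum_{m=k}^\infty\binom{m}{k}a_mX^{m-k}$, where $\binom{m}{k}$ denotes the image in $\mathbb{K}$ of the integer binomial coefficient; so $\Phi_0=f$. *)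

theory Defs
  imports
    "HOL-Analysis.Abstract_Metric_Spaces"
    "HOL-Library.Extended_Real"
    "HOL-Computational_Algebra.Formal_Power_Series"
    "HOL-Algebra.Algebraic_Closure_Type"
    "HOL-Algebra.Generated_Fields"
    "Jordan_Normal_Form.Char_Poly"
begin

hide_const (open) UnivPoly.coeff UnivPoly.monom Module.smult

text \<open>The algebraic closure of a field \<open>'a\<close> is the type \<open>'a alg_closure\<close>, with embedding
  \<open>to_ac\<close>.  Below, \<open>adjoin S\<close> is the subfield of it generated by the base field and \<open>S\<close>.\<close>

definition adjoin :: "'a::field alg_closure set \<Rightarrow> 'a alg_closure set" where
  "adjoin S = generate_field ring_of_type_algebra (range to_ac \<union> S)"

definition splitting_field :: "'a::field poly \<Rightarrow> 'a alg_closure set" where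
  "splitting_field p = adjoin {x. poly (map_poly to_ac p) x = 0}"


subsection \<open>Matrices\<close>

text \<open>The dimension is explicit because matrices of unspecified size have no zero element,
  so the library's \<open>sum\<close> does not apply to them.\<close>

definition mat_sum :: "nat \<Rightarrow> 'i set \<Rightarrow> ('i \<Rightarrow> 'b::comm_monoid_add mat) \<Rightarrow> 'b mat" where
  "mat_sum n I F = mat n n (\<lambda>(a, b). \<Sum>i\<in>I. F i $$ (a, b))"

definition poly_mat :: "'b::comm_ring_1 poly \<Rightarrow> 'b mat \<Rightarrow> 'b mat" where
  "poly_mat p A = mat_sum (dim_row A) {..degree p} (\<lambda>k. coeff p k \<cdot>\<^sub>m A ^\<^sub>m k)"

definition is_minimal_polynomial :: "'b::field mat \<Rightarrow> 'b poly \<Rightarrow> bool" where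
  "is_minimal_polynomial A p \<longleftrightarrow>
     lead_coeff p = 1 \<and> poly_mat p A = 0\<^sub>m (dim_row A) (dim_row A) \<and>
     (\<forall>q. q \<noteq> 0 \<and> poly_mat q A = 0\<^sub>m (dim_row A) (dim_row A) \<longrightarrow> degree p \<le> degree q)"

definition diagonalizable :: "'b::field mat \<Rightarrow> bool" where
  "diagonalizable A \<longleftrightarrow> (\<exists>D. diagonal_mat D \<and> similar_mat A D)"

definition nilpotent_mat :: "'b::field mat \<Rightarrow> bool" where
  "nilpotent_mat A \<longleftrightarrow> (\<exists>k. A ^\<^sub>m k = 0\<^sub>m (dim_row A) (dim_row A))"

text \<open>Semisimplicity is diagonalizability over the algebraic closure, which is where the two
  parts live.\<close>

definition jordan_chevalley ::
    "'a::field mat \<Rightarrow> 'a alg_closure mat \<Rightarrow> 'a alg_closure mat \<Rightarrow> bool" where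
  "jordan_chevalley A S N \<longleftrightarrow>
     S \<in> carrier_mat (dim_row A) (dim_row A) \<and> N \<in> carrier_mat (dim_row A) (dim_row A) \<and>
     diagonalizable S \<and> nilpotent_mat N \<and> S * N = N * S \<and> map_mat to_ac A = S + N"

definition semisimple_part :: "'a::field mat \<Rightarrow> 'a alg_closure mat" where
  "semisimple_part A = (THE S. \<exists>N. jordan_chevalley A S N)"

definition nilpotent_part :: "'a::field mat \<Rightarrow> 'a alg_closure mat" where
  "nilpotent_part A = (THE N. \<exists>S. jordan_chevalley A S N)"


subsection \<open>Absolute values and power series\<close>

definition absolute_value :: "('b::field \<Rightarrow> real) \<Rightarrow> bool" where
  "absolute_value v \<longleftrightarrow>
     (\<forall>x. 0 \<le> v x) \<and> (\<forall>x. v x = 0 \<longleftrightarrow> x = 0) \<and>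
     (\<forall>x y. v (x + y) \<le> v x + v y) \<and> (\<forall>x y. v (x * y) = v x * v y)"

definition av_topology :: "('b::field \<Rightarrow> real) \<Rightarrow> 'b topology" where
  "av_topology v = Metric_space.mtopology UNIV (\<lambda>x y. v (x - y))"

definition complete_valued_field :: "('b::field \<Rightarrow> real) \<Rightarrow> bool" where
  "complete_valued_field v \<longleftrightarrow>
     absolute_value v \<and> (\<exists>x. x \<noteq> 0 \<and> v x \<noteq> 1) \<and>
     Metric_space.mcomplete UNIV (\<lambda>x y. v (x - y))"

text \<open>For \<open>v\<close> complete and non-trivial there is exactly one such \<open>w\<close>.\<close>

definition extends_absolute_value ::
    "('a::field \<Rightarrow> real) \<Rightarrow> ('a alg_closure \<Rightarrow> real) \<Rightarrow> bool" where
  "extends_absolute_value v w \<longleftrightarrow> absolute_value w \<and> (\<forall>x. w (to_ac x) = v x)"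

definition av_spectral_radius :: "('a::field alg_closure \<Rightarrow> real) \<Rightarrow> 'a mat \<Rightarrow> real" where
  "av_spectral_radius w A = Max (w ` {x. eigenvalue (map_mat to_ac A) x})"

definition radius_of_convergence :: "('a::field \<Rightarrow> real) \<Rightarrow> 'a fps \<Rightarrow> ereal" where
  "radius_of_convergence v f =
     (SUP t\<in>{t. 0 \<le> t \<and> bdd_above (range (\<lambda>m. v (fps_nth f m) * t ^ m))}. ereal t)"

text \<open>Convergence in the product topology on \<open>n \<times> n\<close> matrices is entrywise convergence.\<close>

definition mat_limit :: "('b::field \<Rightarrow> real) \<Rightarrow> nat \<Rightarrow> (nat \<Rightarrow> 'b mat) \<Rightarrow> 'b mat \<Rightarrow> bool" where
  "mat_limit v n A L \<longleftrightarrow>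
     (\<forall>i<n. \<forall>j<n. limitin (av_topology v) (\<lambda>N. A N $$ (i, j)) (L $$ (i, j)) sequentially)"

text \<open>The term of index \<open>m \<ge> k\<close> in \<open>\<Phi>\<^sub>k(x) = \<Sum>m\<ge>k. (m choose k) a\<^sub>m x\<^bsup>m-k\<^esup>\<close>, for the
  coefficient sequence \<open>a\<close>.\<close>

definition Phi_term ::
    "(nat \<Rightarrow> 'a::field) \<Rightarrow> nat \<Rightarrow> 'a alg_closure \<Rightarrow> nat \<Rightarrow> 'a alg_closure" where
  "Phi_term a k x m = to_ac (of_nat (m choose k) * a m) * x ^ (m - k)"

end

theory Submission
  imports Defs
begin

text \<open>
  Write \<open>A\<close> for \<open>M\<close> over the algebraic closure and \<open>P = \<Prod>(t - \<lambda>\<^sub>i\<^sub>j) ^ \<eta>\<^sub>i\<close> for its minimal polynomial.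
  As \<open>P\<close> annihilates \<open>A\<close>, evaluation at \<open>A\<close> only sees polynomials modulo \<open>P\<close>, and there the
  \<open>C\<^sub>i\<^sub>j\<close> are orthogonal idempotents with sum \<open>1\<close> such that \<open>(t - \<lambda>\<^sub>i\<^sub>j) ^ \<eta>\<^sub>i * C\<^sub>i\<^sub>j\<close> vanishes.  Expanding
  \<open>t ^ l\<close> around \<open>\<lambda>\<^sub>i\<^sub>j\<close> next to each \<open>C\<^sub>i\<^sub>j\<close> gives the formula for the power \<open>A ^ l\<close>
  (\<open>pow_mat_resolution\<close>), hence by linearity for every polynomial and every partial sum of a power
  series.

  Power series.  The same formula bounds the entries of \<open>A ^ l\<close> by \<open>K * s ^ l\<close> for each \<open>s\<close>
  beyond the spectral radius.  The series \<open>\<Sum>l. (l choose k) a\<^sub>l M ^ (l - k)\<close> therefore converges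
  entrywise in the complete base field.  The scalar series \<open>\<Phi>\<^sub>k(\<lambda>)\<close> lives in the algebraic closure,
  which need not be complete.  But on an eigenvector \<open>u\<close> of \<open>A\<close> the matrix series acts as the
  scalar series, so dividing by a nonzero coordinate of \<open>u\<close> yields convergence.  Moreover \<open>u\<close> can be
  chosen with coordinates in the splitting field (\<open>eigenvector_in_adjoin\<close>), and then the limit
  lies there too.  The formula for \<open>f(M)\<close> follows by passing to the limit in the one for the partial
  sums.  Convergence is known at eigenvalues only, but if a root \<open>\<lambda>\<^sub>i\<^sub>j\<close> were no eigenvalue, then
  \<open>C\<^sub>i\<^sub>j(A)\<close> would be \<open>0\<close> and its terms would disappear (\<open>block_0_or_eigenvalue\<close>).

  The two parts.  Take arbitrary coefficients in place of the \<open>\<Phi>\<^sub>k(\<lambda>\<^sub>i\<^sub>j)\<close>.  The part of the formula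
  with \<open>k = 0\<close> is a combination of the projections \<open>C\<^sub>i\<^sub>j(A)\<close>, so it is diagonalizable.  The rest is
  the value of a polynomial divisible by every \<open>t - \<lambda>\<^sub>i\<^sub>j\<close>, so \<open>P\<close> divides a power of that polynomial
  and the rest is nilpotent.  Both are polynomials in \<open>A\<close> and commute.  Uniqueness of the
  Jordan--Chevalley decomposition (\<open>jordan_chevalley_unique\<close>) identifies them with the semisimple and
  nilpotent parts.
\<close>

section \<open>Evaluating polynomials at a matrix\<close>

lemma mat_sum_carrier [simp]: "mat_sum n I F \<in> carrier_mat n n"
  by (simp add: mat_sum_def)

lemma mat_sum_dim [simp]: "dim_row (mat_sum n I F) = n" "dim_col (mat_sum n I F) = n"
  by (simp_all add: mat_sum_def)

lemma mat_sum_index [simp]: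
  "a < n \<Longrightarrow> b < n \<Longrightarrow> mat_sum n I F $$ (a, b) = (\<Sum>i\<in>I. F i $$ (a, b))"
  by (simp add: mat_sum_def)

lemma poly_mat_carrier [simp]: "A \<in> carrier_mat n n \<Longrightarrow> poly_mat p A \<in> carrier_mat n n"
  by (auto simp: poly_mat_def)

lemma poly_mat_dim [simp]:
  "dim_row (poly_mat p A) = dim_row A" "dim_col (poly_mat p A) = dim_row A"
  by (simp_all add: poly_mat_def)

lemma poly_mat_index:
  assumes A: "A \<in> carrier_mat n n" and ab: "a < n" "b < n" and deg: "degree p < N"
  shows "poly_mat p A $$ (a, b) = (\<Sum>k<N. coeff p k * (A ^\<^sub>m k) $$ (a, b))"
proof -
  have "poly_mat p A $$ (a, b) = (\<Sum>k\<le>degree p. coeff p k * (A ^\<^sub>m k) $$ (a, b))"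
    using A ab by (auto simp: poly_mat_def intro!: sum.cong)
  also have "\<dots> = (\<Sum>k<N. coeff p k * (A ^\<^sub>m k) $$ (a, b))"
    using deg by (intro sum.mono_neutral_left) (auto simp: coeff_eq_0)
  finally show ?thesis .
qed

lemma poly_mat_add:
  assumes A: "A \<in> carrier_mat n n"
  shows "poly_mat (p + q) A = poly_mat p A + poly_mat q A"
proof (rule eq_matI)
  fix a b assume "a < dim_row (poly_mat p A + poly_mat q A)"
    "b < dim_col (poly_mat p A + poly_mat q A)"
  then have ab: "a < n" "b < n" using A by auto
  define N where "N = Suc (max (degree p) (degree q))"
  have N: "degree p < N" "degree q < N" "degree (p + q) < N"
    using degree_add_le_max[of p q] by (auto simp: N_def)
  show "poly_mat (p + q) A $$ (a, b) = (poly_mat p A + poly_mat q A) $$ (a, b)"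
    using A ab by (simp add: poly_mat_index[OF A ab N(1)] poly_mat_index[OF A ab N(2)]
      poly_mat_index[OF A ab N(3)] sum.distrib algebra_simps)
qed (use A in auto)

lemma poly_mat_0 [simp]: "poly_mat 0 A = 0\<^sub>m (dim_row A) (dim_row A)"
  by (intro eq_matI) (auto simp: poly_mat_def)

lemma poly_mat_smult:
  assumes A: "A \<in> carrier_mat n n"
  shows "poly_mat (smult c p) A = c \<cdot>\<^sub>m poly_mat p A"
proof (rule eq_matI)
  fix a b assume "a < dim_row (c \<cdot>\<^sub>m poly_mat p A)" "b < dim_col (c \<cdot>\<^sub>m poly_mat p A)"
  then have ab: "a < n" "b < n" using A by auto
  have "degree (smult c p) < Suc (degree p)" using degree_smult_le[of c p] by simp
  from poly_mat_index[OF A ab this] poly_mat_index[OF A ab lessI]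
  show "poly_mat (smult c p) A $$ (a, b) = (c \<cdot>\<^sub>m poly_mat p A) $$ (a, b)"
    using A ab by (simp add: sum_distrib_left mult.assoc del: sum.lessThan_Suc)
qed (use A in auto)

lemma poly_mat_pCons:
  assumes A: "A \<in> carrier_mat n n"
  shows "poly_mat (pCons c p) A = c \<cdot>\<^sub>m 1\<^sub>m n + poly_mat p A * A"
proof (rule eq_matI)
  fix a b assume "a < dim_row (c \<cdot>\<^sub>m 1\<^sub>m n + poly_mat p A * A)"
    "b < dim_col (c \<cdot>\<^sub>m 1\<^sub>m n + poly_mat p A * A)"
  then have ab: "a < n" "b < n" using A by auto
  have deg: "degree (pCons c p) < Suc (Suc (degree p))" by (simp add: degree_pCons_le le_imp_less_Suc)
  have "(poly_mat p A * A) $$ (a, b) = (\<Sum>j<n. poly_mat p A $$ (a, j) * A $$ (j, b))"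
    using A ab by (simp add: scalar_prod_def atLeast0LessThan)
  also have "\<dots> = (\<Sum>j<n. \<Sum>k<Suc (degree p). coeff p k * (A ^\<^sub>m k) $$ (a, j) * A $$ (j, b))"
    by (intro sum.cong refl)
      (simp add: poly_mat_index[OF A ab(1) _ lessI] sum_distrib_right del: sum.lessThan_Suc)
  also have "\<dots> = (\<Sum>k<Suc (degree p). coeff p k * (\<Sum>j<n. (A ^\<^sub>m k) $$ (a, j) * A $$ (j, b)))"
    by (subst sum.swap) (simp add: sum_distrib_left mult.assoc del: sum.lessThan_Suc)
  also have "\<dots> = (\<Sum>k<Suc (degree p). coeff p k * (A ^\<^sub>m Suc k) $$ (a, b))"
    using A ab by (intro sum.cong refl) (simp add: scalar_prod_def atLeast0LessThan)
  finally have "(c \<cdot>\<^sub>m 1\<^sub>m n + poly_mat p A * A) $$ (a, b) =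
      c * (A ^\<^sub>m 0) $$ (a, b) + (\<Sum>k<Suc (degree p). coeff p k * (A ^\<^sub>m Suc k) $$ (a, b))"
    using A ab by simp
  also have "\<dots> = (\<Sum>k<Suc (Suc (degree p)). coeff (pCons c p) k * (A ^\<^sub>m k) $$ (a, b))"
    by (subst (2) sum.lessThan_Suc_shift) simp
  also have "\<dots> = poly_mat (pCons c p) A $$ (a, b)"
    by (rule poly_mat_index[OF A ab deg, symmetric])
  finally show "poly_mat (pCons c p) A $$ (a, b) = (c \<cdot>\<^sub>m 1\<^sub>m n + poly_mat p A * A) $$ (a, b)" ..
qed (use A in auto)

lemma poly_mat_const:
  "A \<in> carrier_mat n n \<Longrightarrow> poly_mat [:c:] A = c \<cdot>\<^sub>m 1\<^sub>m n"
  by (subst poly_mat_pCons) auto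

lemma poly_mat_1 [simp]: "A \<in> carrier_mat n n \<Longrightarrow> poly_mat 1 A = 1\<^sub>m n"
  by (simp add: one_pCons poly_mat_const) (auto intro!: eq_matI)

lemma poly_mat_mult:
  assumes A: "A \<in> carrier_mat n n"
  shows "poly_mat (p * q) A = poly_mat p A * poly_mat q A"
proof (induction q)
  case 0
  then show ?case using A by simp
next
  case (pCons c q)
  have P: "poly_mat p A \<in> carrier_mat n n" and Q: "poly_mat q A \<in> carrier_mat n n"
    using A by auto
  have "poly_mat (p * pCons c q) A = c \<cdot>\<^sub>m poly_mat p A + (0 \<cdot>\<^sub>m 1\<^sub>m n + poly_mat p A * poly_mat q A * A)"
    using A by (simp add: poly_mat_add poly_mat_smult poly_mat_pCons[OF A, of 0] pCons.IH)
  also have "\<dots> = c \<cdot>\<^sub>m poly_mat p A + poly_mat p A * poly_mat q A * A"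
    using A by (intro eq_matI) auto
  also have "\<dots> = poly_mat p A * (c \<cdot>\<^sub>m 1\<^sub>m n) + poly_mat p A * (poly_mat q A * A)"
    using P by (simp add: mult_smult_distrib[OF P one_carrier_mat] assoc_mult_mat[OF P Q A]
        right_mult_one_mat[OF P])
  also have "\<dots> = poly_mat p A * (c \<cdot>\<^sub>m 1\<^sub>m n + poly_mat q A * A)"
    using A Q by (intro mult_add_distrib_mat[OF P, symmetric]) auto
  finally show ?case by (simp add: poly_mat_pCons[OF A])
qed

lemma poly_mat_power:
  "A \<in> carrier_mat n n \<Longrightarrow> poly_mat (p ^ k) A = poly_mat p A ^\<^sub>m k"
proof (induction k)
  case (Suc k)
  then show ?case by (simp add: poly_mat_mult power_Suc2 del: power_Suc)
qed auto

lemma poly_mat_sum: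
  assumes A: "A \<in> carrier_mat n n"
  shows "poly_mat (\<Sum>i\<in>I. q i) A = mat_sum n I (\<lambda>i. poly_mat (q i) A)"
proof (induction I rule: infinite_finite_induct)
  case (insert i I)
  then show ?case using A by (intro eq_matI) (auto simp: poly_mat_add)
qed (use A in \<open>auto intro!: eq_matI\<close>)

lemma poly_mat_linear:
  assumes A: "A \<in> carrier_mat n n"
  shows "poly_mat [:- c, 1:] A = A - c \<cdot>\<^sub>m 1\<^sub>m n"
  using A by (simp add: poly_mat_pCons[OF A]) (intro eq_matI, auto)

lemma poly_mat_commute:
  "A \<in> carrier_mat n n \<Longrightarrow> poly_mat p A * poly_mat q A = poly_mat q A * poly_mat p A"
  by (metis poly_mat_mult mult.commute)

lemma poly_mat_X_power:
  assumes A: "A \<in> carrier_mat n n"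
  shows "poly_mat ([:0, 1:] ^ k) A = A ^\<^sub>m k"
proof -
  have "0 \<cdot>\<^sub>m 1\<^sub>m n + 1\<^sub>m n * A = A" using A by (intro eq_matI) auto
  then have "poly_mat [:0, 1:] A = A"
    using A by (simp add: poly_mat_pCons[OF A, of 0] one_pCons[symmetric])
  then show ?thesis using A by (simp add: poly_mat_power)
qed

text \<open>Evaluation at \<open>A\<close> factors through the quotient by any annihilating polynomial, so matrix
  identities below become congruences between polynomials.\<close>

lemma poly_mat_eq_0_if_dvd:
  assumes A: "A \<in> carrier_mat n n" and p: "poly_mat p A = 0\<^sub>m n n" and "p dvd q"
  shows "poly_mat q A = 0\<^sub>m n n"
  using assms by (auto simp: dvd_def poly_mat_mult)

lemma poly_mat_eq_if_dvd_diff: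
  assumes A: "A \<in> carrier_mat n n" and p: "poly_mat p A = 0\<^sub>m n n" and "p dvd q - r"
  shows "poly_mat q A = poly_mat r A"
proof -
  have "poly_mat q A = poly_mat (q - r) A + poly_mat r A"
    by (simp add: poly_mat_add[OF A, symmetric])
  then show ?thesis using A by (simp add: poly_mat_eq_0_if_dvd[OF assms])
qed

lemma smult_mat_mult_vec:
  "A \<in> carrier_mat n m \<Longrightarrow> v \<in> carrier_vec m \<Longrightarrow> (c \<cdot>\<^sub>m A) *\<^sub>v v = c \<cdot>\<^sub>v (A *\<^sub>v v)"
  by (intro eq_vecI) (auto simp: scalar_prod_def sum_distrib_left mult.assoc)

lemma zero_mat_mult_vec: "v \<in> carrier_vec m \<Longrightarrow> 0\<^sub>m n m *\<^sub>v v = 0\<^sub>v n"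
  by (intro eq_vecI) (auto simp: scalar_prod_def)

lemma poly_mat_eigenvector:
  fixes A :: "'b::field mat"
  assumes A: "A \<in> carrier_mat n n" and v: "v \<in> carrier_vec n" and ev: "A *\<^sub>v v = x \<cdot>\<^sub>v v"
  shows "poly_mat p A *\<^sub>v v = poly p x \<cdot>\<^sub>v v"
proof (induction p)
  case 0
  then show ?case using A v by (intro eq_vecI) (auto simp: scalar_prod_def)
next
  case (pCons c p)
  have P: "poly_mat p A \<in> carrier_mat n n" using A by auto
  have "poly_mat (pCons c p) A *\<^sub>v v = (c \<cdot>\<^sub>m 1\<^sub>m n) *\<^sub>v v + (poly_mat p A * A) *\<^sub>v v"
    unfolding poly_mat_pCons[OF A] using A P v by (intro add_mult_distrib_mat_vec) auto
  also have "\<dots> = c \<cdot>\<^sub>v v + poly_mat p A *\<^sub>v (A *\<^sub>v v)"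
    using v by (simp add: smult_mat_mult_vec[OF one_carrier_mat v] assoc_mult_mat_vec[OF P A v])
  also have "\<dots> = c \<cdot>\<^sub>v v + x \<cdot>\<^sub>v (poly p x \<cdot>\<^sub>v v)"
    using v P by (simp add: ev mult_mat_vec[OF P v] pCons.IH)
  also have "\<dots> = poly (pCons c p) x \<cdot>\<^sub>v v"
    using v by (intro eq_vecI) (auto simp: algebra_simps)
  finally show ?case .
qed

lemma eigenvalue_is_root:
  fixes A :: "'b::field mat"
  assumes A: "A \<in> carrier_mat n n" and p: "poly_mat p A = 0\<^sub>m n n" and ev: "eigenvalue A x"
  shows "poly p x = 0"
proof -
  obtain v where v: "v \<in> carrier_vec n" "v \<noteq> 0\<^sub>v n" "A *\<^sub>v v = x \<cdot>\<^sub>v v"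
    using ev A by (auto simp: eigenvalue_def eigenvector_def)
  have eq: "poly p x \<cdot>\<^sub>v v = 0\<^sub>v n"
    using poly_mat_eigenvector[OF A v(1,3), of p] v(1) p
    by (metis zero_mat_mult_vec)
  from v(1,2) obtain i where i: "i < n" "vec_index v i \<noteq> 0"
    by (metis eq_vecI carrier_vecD index_zero_vec(1,2))
  have "poly p x * vec_index v i = 0"
    using arg_cong[OF eq, of "\<lambda>u. vec_index u i"] i v(1) by simp
  with i show ?thesis by simp
qed

interpretation to_ac: field_hom "to_ac :: 'a::field \<Rightarrow> 'a alg_closure"
  by standard auto

lemma map_mat_to_ac_pow:
  assumes "A \<in> carrier_mat n n"
  shows "map_mat to_ac (A ^\<^sub>m k) = map_mat to_ac A ^\<^sub>m k"
  by (rule to_ac.mat_hom_pow[OF assms])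

lemma map_mat_poly_mat:
  assumes A: "A \<in> carrier_mat n n"
  shows "map_mat to_ac (poly_mat p A) = poly_mat (map_poly to_ac p) (map_mat to_ac A)"
proof (rule eq_matI)
  have A': "map_mat to_ac A \<in> carrier_mat n n" using A by auto
  fix a b assume "a < dim_row (poly_mat (map_poly to_ac p) (map_mat to_ac A))"
    "b < dim_col (poly_mat (map_poly to_ac p) (map_mat to_ac A))"
  then have ab: "a < n" "b < n" using A by auto
  have "degree (map_poly to_ac p) < Suc (degree p)" by (simp add: le_imp_less_Suc degree_map_poly_le)
  from poly_mat_index[OF A' ab this] poly_mat_index[OF A ab lessI, of p] A ab
  show "map_mat to_ac (poly_mat p A) $$ (a, b) =
      poly_mat (map_poly to_ac p) (map_mat to_ac A) $$ (a, b)"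
    by (simp add: to_ac_sum coeff_map_poly map_mat_to_ac_pow[OF A, symmetric]
        del: sum.lessThan_Suc)
qed (use A in auto)

section \<open>Diagonalizability and the Jordan--Chevalley decomposition\<close>

text \<open>Expanding the determinant of the identity along its rows
  \<open>e\<^sub>a = \<Sum>i. row (E i) a\<close> gives a sum of determinants of matrices whose rows are left
  eigenvectors of \<open>S\<close>.  As the sum is \<open>1\<close>, one of these matrices is invertible, and it
  conjugates \<open>S\<close> to a diagonal matrix.\<close>

lemma diagonalizable_if_projections:
  fixes S :: "'b::field mat" and I :: "'i set"
  assumes S: "S \<in> carrier_mat n n" and fin: "finite I"
    and E: "\<And>i. i \<in> I \<Longrightarrow> E i \<in> carrier_mat n n"
    and ES: "\<And>i. i \<in> I \<Longrightarrow> E i * S = c i \<cdot>\<^sub>m E i"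
    and sum: "mat_sum n I E = 1\<^sub>m n"
  shows "diagonalizable S"
proof -
  (* The expansion lemma for determinants needs natural numbers as indices. *)
  obtain g :: "nat \<Rightarrow> 'i" and s where g: "bij_betw g {..<s} I"
    using ex_bij_betw_nat_finite[OF fin] by (metis atLeast0LessThan)
  have gI: "g k \<in> I" if "k < s" for k using g that by (auto simp: bij_betw_def)
  define R where "R f = mat\<^sub>r n n (\<lambda>a. row (E (g (f a))) a)" for f
  have "1\<^sub>m n = mat\<^sub>r n n (\<lambda>a. finsum_vec TYPE('b) n (\<lambda>k. row (E (g k)) a) {..<s})"
  proof (rule eq_matI)
    fix a b assume "a < dim_row (mat\<^sub>r n n (\<lambda>a. finsum_vec TYPE('b) n (\<lambda>k. row (E (g k)) a) {..<s}))"
      "b < dim_col (mat\<^sub>r n n (\<lambda>a. finsum_vec TYPE('b) n (\<lambda>k. row (E (g k)) a) {..<s}))"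
    then have ab: "a < n" "b < n" by auto
    have "1\<^sub>m n $$ (a, b) = (\<Sum>i\<in>I. E i $$ (a, b))" using ab by (simp add: sum[symmetric])
    also have "\<dots> = (\<Sum>k<s. E (g k) $$ (a, b))" by (rule sum.reindex_bij_betw[OF g, symmetric])
    also have "\<dots> = (\<Sum>k<s. vec_index (row (E (g k)) a) b)"
      using ab carrier_matD[OF E[OF gI]] by (intro sum.cong refl) auto
    finally show "1\<^sub>m n $$ (a, b) =
        mat\<^sub>r n n (\<lambda>a. finsum_vec TYPE('b) n (\<lambda>k. row (E (g k)) a) {..<s}) $$ (a, b)"
      using ab row_carrier_vec[OF _ E[OF gI]]
      by (simp add: index_finsum_vec[of _ _ n "\<lambda>k. row (E (g k)) a"] Pi_def)
  qed auto
  then have "1 = det (mat\<^sub>r n n (\<lambda>a. finsum_vec TYPE('b) n (\<lambda>k. row (E (g k)) a) {..<s}))"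
    by (metis det_one)
  also have "\<dots> = (\<Sum>f\<in>{f. (\<forall>a\<in>{0..<n}. f a \<in> {..<s}) \<and> (\<forall>a. a \<notin> {0..<n} \<longrightarrow> f a = a)}. det (R f))"
    unfolding R_def using E[OF gI] by (intro det_linear_rows_sum) (auto intro!: row_carrier_vec)
  finally have "(\<Sum>f\<in>{f. (\<forall>a\<in>{0..<n}. f a \<in> {..<s}) \<and> (\<forall>a. a \<notin> {0..<n} \<longrightarrow> f a = a)}. det (R f)) \<noteq> 0"
    by simp
  then obtain f where "f \<in> {f. (\<forall>a\<in>{0..<n}. f a \<in> {..<s}) \<and> (\<forall>a. a \<notin> {0..<n} \<longrightarrow> f a = a)}"
    and det: "det (R f) \<noteq> 0"
    by (rule sum.not_neutral_contains_not_neutral)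
  then have f: "f a < s" if "a < n" for a using that by auto
  define Q where "Q = R f"
  define D where "D = mat_diag n (\<lambda>a. c (g (f a)))"
  have Q: "Q \<in> carrier_mat n n" by (simp add: Q_def R_def)
  have D: "D \<in> carrier_mat n n" by (simp add: D_def mat_diag_def)
  have "Q * S = D * Q"
  proof (rule eq_matI)
    fix a b assume "a < dim_row (D * Q)" "b < dim_col (D * Q)"
    then have ab: "a < n" "b < n" using Q D by auto
    let ?i = "g (f a)"
    have i: "?i \<in> I" using gI f ab by blast
    have row: "row Q a = row (E ?i) a"
      using ab E[OF i] by (auto simp: Q_def R_def intro!: eq_vecI)
    have "(Q * S) $$ (a, b) = (E ?i * S) $$ (a, b)"
      using ab Q S E[OF i] by (simp add: row)
    also have "\<dots> = c ?i * vec_index (row Q a) b"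
      unfolding ES[OF i] row using ab E[OF i] by simp
    also have "\<dots> = (D * Q) $$ (a, b)"
      unfolding D_def using ab Q by (subst mat_diag_mult_left[OF Q]) auto
    finally show "(Q * S) $$ (a, b) = (D * Q) $$ (a, b)" .
  qed (use Q S D in auto)
  moreover obtain P where P: "P \<in> carrier_mat n n" and PQ: "P * Q = 1\<^sub>m n" "Q * P = 1\<^sub>m n"
    using det_non_zero_imp_unit[OF Q] det by (auto simp: Units_def ring_mat_def Q_def)
  ultimately have "S = P * D * Q"
    using assoc_mult_mat[OF P Q S] assoc_mult_mat[OF P D Q] S by simp
  then have "similar_mat S D"
    using P Q S D PQ by (intro similar_matI[of _ _ P Q n]) auto
  moreover have "diagonal_mat D" by (auto simp: D_def mat_diag_def diagonal_mat_def)
  ultimately show ?thesis by (auto simp: diagonalizable_def)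
qed

lemma pow_mat_Suc_vec:
  assumes "A \<in> carrier_mat n n" "v \<in> carrier_vec n"
  shows "A ^\<^sub>m Suc k *\<^sub>v v = A ^\<^sub>m k *\<^sub>v (A *\<^sub>v v)"
  using assms by (simp add: assoc_mult_mat_vec[of _ n n])

lemma mult_mat_zero_vec: "A \<in> carrier_mat n m \<Longrightarrow> A *\<^sub>v 0\<^sub>v m = 0\<^sub>v n"
  by (intro eq_vecI) (auto simp: scalar_prod_def)

lemma mult_pow_mat_commute_vec:
  assumes "T \<in> carrier_mat n n" "U \<in> carrier_mat n n" "T * U = U * T" "v \<in> carrier_vec n"
  shows "T ^\<^sub>m k *\<^sub>v (U *\<^sub>v v) = U *\<^sub>v (T ^\<^sub>m k *\<^sub>v v)"
  using assms(4)
proof (induction k arbitrary: v)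
  case (Suc k)
  have Tv: "T *\<^sub>v v \<in> carrier_vec n" using assms Suc.prems by auto
  have "T *\<^sub>v (U *\<^sub>v v) = U *\<^sub>v (T *\<^sub>v v)"
    using assms(1-3) Suc.prems by (metis assoc_mult_mat_vec)
  then show ?case
    using assms Suc.prems Suc.IH[OF Tv]
    by (simp add: pow_mat_Suc_vec mult_mat_vec_carrier[OF assms(2)] del: pow_mat.simps)
qed (use assms in auto)

text \<open>Apply one factor \<open>T + U\<close> to \<open>v\<close> and induct on \<open>k + l\<close>: \<open>T v\<close> is already killed by
  \<open>T ^ (k - 1)\<close> and still by \<open>U ^ l\<close>, and symmetrically for \<open>U v\<close>.\<close>

lemma commuting_sum_kills:
  fixes T U :: "'b::comm_ring_1 mat"
  assumes T: "T \<in> carrier_mat n n" and U: "U \<in> carrier_mat n n" and TU: "T * U = U * T"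
    and "v \<in> carrier_vec n" "T ^\<^sub>m k *\<^sub>v v = 0\<^sub>v n" "U ^\<^sub>m l *\<^sub>v v = 0\<^sub>v n"
  shows "(T + U) ^\<^sub>m (k + l) *\<^sub>v v = 0\<^sub>v n"
  using assms(4-)
proof (induction "k + l" arbitrary: k l v)
  case 0
  then show ?case using T U by simp
next
  case (Suc m)
  have S: "(T + U) ^\<^sub>m j \<in> carrier_mat n n" for j using T U by simp
  have Tv: "T *\<^sub>v v \<in> carrier_vec n" and Uv: "U *\<^sub>v v \<in> carrier_vec n"
    using T U Suc.prems by auto
  show ?case
  proof (cases "k = 0 \<or> l = 0")
    case True
    then have "v = 0\<^sub>v n" using Suc.prems T U by auto
    then show ?thesis using mult_mat_zero_vec[OF S] by simp
  next
    case False
    then obtain k' l' where kl: "k = Suc k'" "l = Suc l'" by (metis not0_implies_Suc)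
    have "(T + U) ^\<^sub>m m *\<^sub>v (T *\<^sub>v v) = 0\<^sub>v n"
      using Suc.hyps(1)[of k' l "T *\<^sub>v v"] Suc.hyps(2) Suc.prems kl Tv
        mult_pow_mat_commute_vec[OF U T TU[symmetric] Suc.prems(1), of l] mult_mat_zero_vec[OF T]
      by (simp add: pow_mat_Suc_vec[OF T Suc.prems(1)] del: pow_mat.simps)
    moreover have "(T + U) ^\<^sub>m m *\<^sub>v (U *\<^sub>v v) = 0\<^sub>v n"
      using Suc.hyps(1)[of k l' "U *\<^sub>v v"] Suc.hyps(2) Suc.prems kl Uv
        mult_pow_mat_commute_vec[OF T U TU Suc.prems(1), of k] mult_mat_zero_vec[OF U]
      by (simp add: pow_mat_Suc_vec[OF U Suc.prems(1)] del: pow_mat.simps)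
    moreover have "(T + U) ^\<^sub>m Suc m *\<^sub>v v =
        (T + U) ^\<^sub>m m *\<^sub>v (T *\<^sub>v v) + (T + U) ^\<^sub>m m *\<^sub>v (U *\<^sub>v v)"
      using T U Tv Uv S Suc.prems(1)
      by (simp add: pow_mat_Suc_vec[of _ n] add_mult_distrib_mat_vec[OF T U]
          mult_add_distrib_mat_vec[OF S] del: pow_mat.simps)
    ultimately show ?thesis using Suc.hyps(2) by simp
  qed
qed

lemma pow_mat_diag: "mat_diag n f ^\<^sub>m k = mat_diag n (\<lambda>a. f a ^ k)"
proof (induction k)
  case 0
  then show ?case by (intro eq_matI) (auto simp: mat_diag_def)
next
  case (Suc k)
  then show ?case by (simp add: mat_diag_diag power_Suc2 del: power_Suc)
qed

lemma pow_mat_smult: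
  fixes A :: "'b::comm_ring_1 mat"
  assumes A: "A \<in> carrier_mat n n"
  shows "(c \<cdot>\<^sub>m A) ^\<^sub>m k = c ^ k \<cdot>\<^sub>m A ^\<^sub>m k"
proof (induction k)
  case (Suc k)
  have P: "A ^\<^sub>m k \<in> carrier_mat n n" using A by simp
  have "c ^ k \<cdot>\<^sub>m A ^\<^sub>m k * (c \<cdot>\<^sub>m A) = c ^ k \<cdot>\<^sub>m (c \<cdot>\<^sub>m (A ^\<^sub>m k * A))"
    using A P by (simp add: mult_smult_distrib[OF P A] mult_smult_assoc_mat[OF P smult_carrier_mat[OF A]])
  also have "\<dots> = c ^ Suc k \<cdot>\<^sub>m A ^\<^sub>m Suc k"
    by (intro eq_matI) (auto simp: algebra_simps)
  finally show ?case by (simp add: Suc.IH)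
qed (use A in \<open>auto intro!: eq_matI\<close>)

text \<open>In coordinates that diagonalize \<open>S\<close> the hypothesis reads \<open>(d - c) ^ k * z = 0\<close> for each
  coordinate \<open>z\<close> and diagonal entry \<open>d\<close>, and a field has no nilpotent elements.\<close>

lemma diagonalizable_shift_kernel:
  fixes S :: "'b::field mat"
  assumes S: "S \<in> carrier_mat n n" and diag: "diagonalizable S" and v: "v \<in> carrier_vec n"
    and ker: "(S - c \<cdot>\<^sub>m 1\<^sub>m n) ^\<^sub>m k *\<^sub>v v = 0\<^sub>v n"
  shows "(S - c \<cdot>\<^sub>m 1\<^sub>m n) *\<^sub>v v = 0\<^sub>v n"
proof -
  obtain D P Q where D: "diagonal_mat D" and wit: "similar_mat_wit S D P Q"
    using diag by (auto simp: diagonalizable_def similar_mat_def)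
  note car = similar_mat_witD2[OF S wit]
  define T where "T = D - c \<cdot>\<^sub>m 1\<^sub>m n"
  have T: "T \<in> carrier_mat n n" unfolding T_def by (intro minus_carrier_mat smult_carrier_mat one_carrier_mat)
  have Sc: "S - c \<cdot>\<^sub>m 1\<^sub>m n \<in> carrier_mat n n" by (intro minus_carrier_mat smult_carrier_mat one_carrier_mat)
  have "S - c \<cdot>\<^sub>m 1\<^sub>m n = P * T * Q"
  proof -
    have "P * T * Q = P * D * Q - P * (c \<cdot>\<^sub>m 1\<^sub>m n) * Q"
      unfolding T_def using car
      by (simp add: mult_minus_distrib_mat[of _ n n _ n] minus_mult_distrib_mat[of _ n n _ _ n])
    also have "P * (c \<cdot>\<^sub>m 1\<^sub>m n) * Q = c \<cdot>\<^sub>m 1\<^sub>m n"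
      using car by (simp add: mult_smult_distrib[of _ n n _ n] mult_smult_assoc_mat[of _ n n _ n])
    finally show ?thesis using car by simp
  qed
  then have wit': "similar_mat_wit (S - c \<cdot>\<^sub>m 1\<^sub>m n) T P Q"
    using car T Sc by (intro similar_mat_witI[of _ _ n]) auto
  define u where "u = Q *\<^sub>v v"
  have u: "u \<in> carrier_vec n" using car v by (simp add: u_def)
  have diagT: "T ^\<^sub>m j = mat_diag n (\<lambda>a. T $$ (a, a) ^ j)" for j
  proof -
    have "T = mat_diag n (\<lambda>a. T $$ (a, a))"
      using D car T by (intro eq_matI) (auto simp: T_def diagonal_mat_def mat_diag_def)
    then show ?thesis by (metis pow_mat_diag)
  qed
  have pw: "(S - c \<cdot>\<^sub>m 1\<^sub>m n) ^\<^sub>m j *\<^sub>v v = P *\<^sub>v (T ^\<^sub>m j *\<^sub>v u)" for j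
  proof -
    have PT: "P * T ^\<^sub>m j \<in> carrier_mat n n" using car(6) T by simp
    show ?thesis
      unfolding similar_mat_wit_pow_id[OF wit'] u_def assoc_mult_mat_vec[OF PT car(7) v]
      using assoc_mult_mat_vec[OF car(6) pow_carrier_mat[OF T]] u by (simp add: u_def)
  qed
  have entry: "vec_index (T ^\<^sub>m j *\<^sub>v u) a = T $$ (a, a) ^ j * vec_index u a" if "a < n" for j a
  proof -
    have "vec_index (T ^\<^sub>m j *\<^sub>v u) a =
        (\<Sum>b\<in>{0..<n}. (if a = b then T $$ (b, b) ^ j else 0) * vec_index u b)"
      using that u unfolding diagT[of j] by (simp add: mat_diag_def scalar_prod_def)
    also have "\<dots> = (\<Sum>b\<in>{0..<n}. if a = b then T $$ (a, a) ^ j * vec_index u b else 0)"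
      by (intro sum.cong) auto
    finally show ?thesis using that by simp
  qed
  have Tu: "T ^\<^sub>m k *\<^sub>v u \<in> carrier_vec n"
    by (rule mult_mat_vec_carrier[OF pow_carrier_mat[OF T] u])
  have "T ^\<^sub>m k *\<^sub>v u = Q *\<^sub>v (P *\<^sub>v (T ^\<^sub>m k *\<^sub>v u))"
    using assoc_mult_mat_vec[OF car(7,6) Tu] Tu by (simp add: car(2))
  also have "\<dots> = 0\<^sub>v n" using mult_mat_zero_vec[OF car(7)] ker by (simp add: pw[symmetric])
  finally have 0: "T $$ (a, a) ^ k * vec_index u a = 0" if "a < n" for a
    using entry[OF that, of k] that by simp
  have "T ^\<^sub>m 1 *\<^sub>v u = 0\<^sub>v n"
  proof (rule eq_vecI)
    fix a assume "a < dim_vec (0\<^sub>v n :: 'b vec)"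
    then show "vec_index (T ^\<^sub>m 1 *\<^sub>v u) a = vec_index (0\<^sub>v n) a"
      using 0[of a] entry[of a 1] by auto
  qed (use T in auto)
  then have "(S - c \<cdot>\<^sub>m 1\<^sub>m n) ^\<^sub>m 1 *\<^sub>v v = 0\<^sub>v n"
    unfolding pw using car by (simp add: mult_mat_zero_vec[of _ n n])
  then show ?thesis using Sc by simp
qed

lemma diagonalizable_eigenvector_basis:
  fixes S :: "'b::field mat"
  assumes S: "S \<in> carrier_mat n n" and diag: "diagonalizable S"
  obtains P Q d where "P \<in> carrier_mat n n" "Q \<in> carrier_mat n n" "P * Q = 1\<^sub>m n"
    and "\<And>b. b < n \<Longrightarrow> (S - d b \<cdot>\<^sub>m 1\<^sub>m n) *\<^sub>v col P b = 0\<^sub>v n"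
proof -
  obtain D P Q where D: "diagonal_mat D" and wit: "similar_mat_wit S D P Q"
    using diag by (auto simp: diagonalizable_def similar_mat_def)
  note car = similar_mat_witD2[OF S wit]
  have "S * P = P * D * (Q * P)"
    using car by (simp add: assoc_mult_mat[of _ n n _ n _ n])
  then have SP: "S * P = P * D" using car by simp
  have "(S - D $$ (b, b) \<cdot>\<^sub>m 1\<^sub>m n) *\<^sub>v col P b = 0\<^sub>v n" if b: "b < n" for b
  proof -
    have colP: "col P b \<in> carrier_vec n" using car b by auto
    have "S *\<^sub>v col P b = P *\<^sub>v col D b"
      using arg_cong[OF SP, of "\<lambda>A. col A b"] b
      by (simp only: col_mult2[OF S car(6) b] col_mult2[OF car(6,5) b])
    also have "\<dots> = D $$ (b, b) \<cdot>\<^sub>v col P b"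
    proof (rule eq_vecI)
      fix a assume "a < dim_vec (D $$ (b, b) \<cdot>\<^sub>v col P b)"
      then have a: "a < n" using car by auto
      have "vec_index (P *\<^sub>v col D b) a = (\<Sum>i\<in>{0..<n}. P $$ (a, i) * D $$ (i, b))"
        using a b car(5,6) by (simp add: scalar_prod_def)
      also have "\<dots> = (\<Sum>i\<in>{0..<n}. if i = b then P $$ (a, i) * D $$ (i, b) else 0)"
        using b car(5) D by (intro sum.cong) (auto simp: diagonal_mat_def)
      finally show "vec_index (P *\<^sub>v col D b) a = vec_index (D $$ (b, b) \<cdot>\<^sub>v col P b) a"
        using a b car by simp
    qed (use car in auto)
    finally have "S *\<^sub>v col P b = D $$ (b, b) \<cdot>\<^sub>v col P b" .
    then show ?thesis
      using S colP by (simp add: minus_mult_distrib_mat_vec[of _ n n] smult_mat_mult_vec[of _ n n])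
  qed
  with car show ?thesis by (intro that[of P Q "\<lambda>b. D $$ (b, b)"]) auto
qed

text \<open>An eigenvector of \<open>S'\<close> is annihilated by a power of \<open>A - c\<close>, since \<open>A\<close> and \<open>S'\<close>
  differ by a commuting nilpotent matrix; for the same reason it is then annihilated by a power
  of \<open>S - c\<close>, hence by \<open>S - c\<close> itself, as \<open>S\<close> is diagonalizable.  So \<open>S\<close> and \<open>S'\<close> agree on a
  basis of eigenvectors of \<open>S'\<close>.\<close>

lemma jordan_chevalley_unique:
  assumes A: "A \<in> carrier_mat n n"
    and SN: "jordan_chevalley A S N" and SN': "jordan_chevalley A S' N'"
  shows "S = S'" "N = N'"
proof -
  define B where "B = map_mat to_ac A"
  have S: "S \<in> carrier_mat n n" "N \<in> carrier_mat n n" "S * N = N * S" "B = S + N"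
    and S': "S' \<in> carrier_mat n n" "N' \<in> carrier_mat n n" "S' * N' = N' * S'" "B = S' + N'"
    using SN SN' A by (auto simp: jordan_chevalley_def B_def)
  obtain k where k: "N ^\<^sub>m k = 0\<^sub>m n n"
    using SN S(2) by (auto simp: jordan_chevalley_def nilpotent_mat_def)
  obtain l where l: "N' ^\<^sub>m l = 0\<^sub>m n n"
    using SN' S'(2) by (auto simp: jordan_chevalley_def nilpotent_mat_def)
  obtain P Q d where P: "P \<in> carrier_mat n n" "Q \<in> carrier_mat n n" "P * Q = 1\<^sub>m n"
    and ev: "\<And>b. b < n \<Longrightarrow> (S' - d b \<cdot>\<^sub>m 1\<^sub>m n) *\<^sub>v col P b = 0\<^sub>v n"
    using diagonalizable_eigenvector_basis[OF S'(1)] SN' by (metis jordan_chevalley_def)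
  have shift: "U - c \<cdot>\<^sub>m 1\<^sub>m n \<in> carrier_mat n n" for U :: "'a alg_closure mat" and c
    by (intro minus_carrier_mat smult_carrier_mat one_carrier_mat)
  have shift_comm: "(U - c \<cdot>\<^sub>m 1\<^sub>m n) * V = V * (U - c \<cdot>\<^sub>m 1\<^sub>m n)"
    if "U \<in> carrier_mat n n" "V \<in> carrier_mat n n" "U * V = V * U"
    for U V :: "'a alg_closure mat" and c
    using that by (simp add: minus_mult_distrib_mat[of _ n n] mult_minus_distrib_mat[of _ n n]
        mult_smult_distrib[of _ n n _ n] mult_smult_assoc_mat[of _ n n _ n])
  have "S * P = S' * P"
  proof (rule mat_col_eqI)
    fix b assume "b < dim_col (S' * P)"
    then have b: "b < n" using P by simp
    define v where "v = col P b"
    have v: "v \<in> carrier_vec n" using P b by (auto simp: v_def)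
    let ?c = "d b \<cdot>\<^sub>m 1\<^sub>m n :: 'a alg_closure mat"
    have "(S' - ?c + N') ^\<^sub>m (1 + l) *\<^sub>v v = 0\<^sub>v n"
      using ev[OF b] S' v l zero_mat_mult_vec[OF v, of n] shift[of S' "d b"]
      by (intro commuting_sum_kills shift shift_comm) (auto simp: v_def)
    also have "S' - ?c + N' = B - ?c" unfolding S'(4) using S'(1,2) by (intro eq_matI) auto
    finally have B_kills: "(B - ?c) ^\<^sub>m (1 + l) *\<^sub>v v = 0\<^sub>v n" .
    have "(- N) ^\<^sub>m k = (- 1) ^ k \<cdot>\<^sub>m N ^\<^sub>m k"
    proof -
      have "- N = (- 1) \<cdot>\<^sub>m N" by (intro eq_matI) auto
      then show ?thesis by (simp add: pow_mat_smult[OF S(2)])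
    qed
    then have N_kills: "(- N) ^\<^sub>m k *\<^sub>v v = 0\<^sub>v n"
      using k v by (simp add: zero_mat_mult_vec)
    have "(B - ?c + - N) ^\<^sub>m (1 + l + k) *\<^sub>v v = 0\<^sub>v n"
    proof (rule commuting_sum_kills[OF shift _ shift_comm v B_kills N_kills])
      have "(S + N) * N = N * (S + N)"
        using S by (simp add: add_mult_distrib_mat[of _ n n] mult_add_distrib_mat[of _ n n])
      then show "B * - N = - N * B" using S by simp
    qed (use S in auto)
    also have "B - ?c + - N = S - ?c" unfolding S(4) using S(1,2) by (intro eq_matI) auto
    finally have "(S - ?c) *\<^sub>v v = 0\<^sub>v n"
      using diagonalizable_shift_kernel[OF S(1) _ v, of "d b" "1 + l + k"] SN
      by (simp only: jordan_chevalley_def)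
    with ev[OF b] have eq: "S *\<^sub>v v - ?c *\<^sub>v v = S' *\<^sub>v v - ?c *\<^sub>v v"
      using S(1) S'(1) v by (simp add: v_def minus_mult_distrib_mat_vec[of _ n n])
    have "vec_index (S *\<^sub>v v) a = vec_index (S' *\<^sub>v v) a" if a: "a < n" for a
    proof -
      have "vec_index (S *\<^sub>v v - ?c *\<^sub>v v) a = vec_index (S' *\<^sub>v v - ?c *\<^sub>v v) a"
        by (simp only: eq)
      then show ?thesis
        using a by (subst (asm) (1 2) index_minus_vec(1)) (simp_all del: index_mult_mat_vec)
    qed
    then have "S *\<^sub>v v = S' *\<^sub>v v" using S(1) S'(1) by (intro eq_vecI) auto
    then show "col (S * P) b = col (S' * P) b"
      by (simp only: v_def col_mult2[OF S(1) P(1) b] col_mult2[OF S'(1) P(1) b])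
  qed (use S S' P in auto)
  then have "S * P * Q = S' * P * Q" by simp
  then show "S = S'"
    using S(1) S'(1) P by (simp add: assoc_mult_mat[of _ n n _ n _ n])
  moreover have "N = B - S" unfolding S(4) using S(1,2) by (intro eq_matI) auto
  moreover have "N' = B - S'" unfolding S'(4) using S'(1,2) by (intro eq_matI) auto
  ultimately show "N = N'" by simp
qed

lemma semisimple_nilpotent_part_eqI:
  assumes "A \<in> carrier_mat n n" "jordan_chevalley A S N"
  shows "semisimple_part A = S" "nilpotent_part A = N"
  using jordan_chevalley_unique[OF assms(1)] assms(2)
  by (auto simp: semisimple_part_def nilpotent_part_def intro!: the_equality)

section \<open>Resolution of the identity by a coprime factorization\<close>

text \<open>The polynomials \<open>C i\<close> represent the idempotents of \<open>K[t] / (p)\<close> attached to the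
  factorization \<open>p = \<Prod>i. (t - x i) ^ e i\<close> of a polynomial annihilating \<open>A\<close>; the divisibility
  requirement says that \<open>C i\<close> is a multiple of \<open>p / (t - x i) ^ e i\<close>.\<close>

locale spectral_resolution =
  fixes A :: "'b::field mat" and n :: nat and I :: "'i set"
    and x :: "'i \<Rightarrow> 'b" and e :: "'i \<Rightarrow> nat" and C :: "'i \<Rightarrow> 'b poly"
  assumes A: "A \<in> carrier_mat n n"
    and fin: "finite I"
    and e_pos: "i \<in> I \<Longrightarrow> 0 < e i"
    and annihilates: "poly_mat (\<Prod>i\<in>I. [:- x i, 1:] ^ e i) A = 0\<^sub>m n n"
    and C_dvd: "i \<in> I \<Longrightarrow> (\<Prod>j\<in>I - {i}. [:- x j, 1:] ^ e j) dvd C i"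
    and C_sum: "(\<Sum>i\<in>I. C i) = 1"
begin

definition annihilator :: "'b poly" where
  "annihilator = (\<Prod>i\<in>I. [:- x i, 1:] ^ e i)"

definition block :: "'i \<Rightarrow> nat \<Rightarrow> 'b mat" where
  "block i k = poly_mat ([:- x i, 1:] ^ k * C i) A"

lemma block_carrier [simp]: "block i k \<in> carrier_mat n n"
  using A by (simp add: block_def)

lemma poly_mat_annihilator: "annihilator dvd q \<Longrightarrow> poly_mat q A = 0\<^sub>m n n"
  using poly_mat_eq_0_if_dvd[OF A] annihilates by (auto simp: annihilator_def)

lemma poly_mat_cong: "annihilator dvd q - q' \<Longrightarrow> poly_mat q A = poly_mat q' A"
  using poly_mat_eq_if_dvd_diff[OF A] annihilates by (auto simp: annihilator_def)

lemma annihilator_split: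
  "i \<in> I \<Longrightarrow> annihilator = [:- x i, 1:] ^ e i * (\<Prod>j\<in>I - {i}. [:- x j, 1:] ^ e j)"
  using fin by (simp add: annihilator_def prod.remove)

lemma annihilator_dvd_power_C:
  assumes "i \<in> I" "e i \<le> k"
  shows "annihilator dvd [:- x i, 1:] ^ k * C i"
  unfolding annihilator_split[OF assms(1)]
  by (intro mult_dvd_mono le_imp_power_dvd C_dvd assms)

lemma factor_dvd_C:
  assumes "i \<in> I" "j \<in> I" "i \<noteq> j"
  shows "[:- x i, 1:] ^ e i dvd C j"
  using assms fin by (intro dvd_trans[OF _ C_dvd[of j]] dvd_prodI) auto

lemma annihilator_dvd_C_mult:
  assumes "i \<in> I" "j \<in> I" "i \<noteq> j"
  shows "annihilator dvd C i * C j"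
proof -
  have "annihilator dvd C j * C i"
    unfolding annihilator_split[OF assms(1)]
    using assms by (intro mult_dvd_mono factor_dvd_C C_dvd) auto
  then show ?thesis by (simp add: mult.commute)
qed

lemma block_eq_0: "i \<in> I \<Longrightarrow> e i \<le> k \<Longrightarrow> block i k = 0\<^sub>m n n"
  unfolding block_def by (intro poly_mat_annihilator annihilator_dvd_power_C)

text \<open>On the image of \<open>C i\<close> the power \<open>t ^ l\<close> may be replaced by its Taylor polynomial of degree
  less than \<open>e i\<close> at \<open>x i\<close>, as \<open>(t - x i) ^ e i * C i\<close> annihilates \<open>A\<close>.\<close>

lemma pow_mat_resolution:
  assumes "a < n" "b < n"
  shows "(A ^\<^sub>m l) $$ (a, b) =
    (\<Sum>i\<in>I. \<Sum>k<e i. of_nat (l choose k) * x i ^ (l - k) * block i k $$ (a, b))"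
proof -
  define t :: "'b poly" where "t = [:0, 1:]"
  have taylor: "t ^ l = (\<Sum>k\<le>l. smult (of_nat (l choose k) * y ^ (l - k)) ([:- y, 1:] ^ k))" for y
  proof -
    have "t = [:- y, 1:] + [:y:]" by (simp add: t_def)
    also have "\<dots> ^ l = (\<Sum>k\<le>l. of_nat (l choose k) * [:- y, 1:] ^ k * [:y:] ^ (l - k))"
      by (rule binomial_ring)
    also have "\<dots> = (\<Sum>k\<le>l. smult (of_nat (l choose k) * y ^ (l - k)) ([:- y, 1:] ^ k))"
      by (intro sum.cong refl) (simp add: poly_const_pow of_nat_poly mult.commute mult.assoc)
    finally show ?thesis .
  qed
  have "t ^ l = (\<Sum>i\<in>I. t ^ l * C i)" by (simp add: sum_distrib_left[symmetric] C_sum)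
  also have "\<dots> = (\<Sum>i\<in>I. \<Sum>k\<le>l. smult (of_nat (l choose k) * x i ^ (l - k)) ([:- x i, 1:] ^ k * C i))"
    by (intro sum.cong refl, subst taylor) (simp add: sum_distrib_right)
  finally have "(A ^\<^sub>m l) $$ (a, b) =
      (\<Sum>i\<in>I. \<Sum>k\<le>l. of_nat (l choose k) * x i ^ (l - k) * block i k $$ (a, b))"
    using assms
    by (simp add: poly_mat_X_power[OF A, of l, folded t_def, symmetric] poly_mat_sum[OF A]
        poly_mat_smult[OF A] block_def carrier_matD[OF A])
  also have "\<dots> = (\<Sum>i\<in>I. \<Sum>k<e i. of_nat (l choose k) * x i ^ (l - k) * block i k $$ (a, b))"
  proof (rule sum.cong[OF refl])
    (* The two index ranges differ by terms with k > l, where the binomial coefficient vanishes,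
       and terms with k \<ge> e i, where the block does. *)
    fix i assume i: "i \<in> I"
    show "(\<Sum>k\<le>l. of_nat (l choose k) * x i ^ (l - k) * block i k $$ (a, b)) =
        (\<Sum>k<e i. of_nat (l choose k) * x i ^ (l - k) * block i k $$ (a, b))"
      using block_eq_0[OF i] assms
      by (intro sum.mono_neutral_cong) (auto simp: not_less not_le binomial_eq_0)
  qed
  finally show ?thesis .
qed

text \<open>If \<open>A - x i\<close> is injective, so is its power \<open>(A - x i) ^ e i\<close>, which annihilates the
  image of \<open>C i\<close>.\<close>

lemma block_0_or_eigenvalue:
  assumes i: "i \<in> I"
  shows "(\<forall>k. block i k = 0\<^sub>m n n) \<or> eigenvalue A (x i)"
proof (rule disjCI)
  assume noev: "\<not> eigenvalue A (x i)"
  have kill: "v = 0\<^sub>v n"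
    if v: "v \<in> carrier_vec n" and 0: "poly_mat ([:- x i, 1:] ^ k) A *\<^sub>v v = 0\<^sub>v n" for v k
    using v 0
  proof (induction k arbitrary: v)
    case 0
    then show ?case using A by simp
  next
    case (Suc k)
    let ?L = "poly_mat [:- x i, 1:] A"
    have L: "?L \<in> carrier_mat n n" using A by simp
    have eq: "poly_mat ([:- x i, 1:] ^ Suc k) A *\<^sub>v v = poly_mat ([:- x i, 1:] ^ k) A *\<^sub>v (?L *\<^sub>v v)"
      using pow_mat_Suc_vec[OF L Suc.prems(1)] by (simp only: poly_mat_power[OF A])
    have "?L *\<^sub>v v = 0\<^sub>v n"
      by (rule Suc.IH[OF mult_mat_vec_carrier[OF L Suc.prems(1)]])
        (simp only: eq[symmetric] Suc.prems(2))
    moreover have "?L = char_matrix A (x i)"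
      unfolding poly_mat_linear[OF A] char_matrix_def using A by (intro eq_matI) auto
    ultimately show ?case using noev Suc.prems(1) by (auto simp: eigenvalue_char_matrix[OF A])
  qed
  have "block i k = 0\<^sub>m n n" for k
  proof (rule mat_col_eqI)
    fix b assume "b < dim_col (0\<^sub>m n n :: 'b mat)"
    then have b: "b < n" by simp
    have "block i (e i + k) = poly_mat ([:- x i, 1:] ^ e i) A * block i k"
      by (simp add: block_def poly_mat_mult[OF A, symmetric] power_add mult.assoc)
    then have "poly_mat ([:- x i, 1:] ^ e i) A *\<^sub>v col (block i k) b = 0\<^sub>v n"
      using block_eq_0[OF i, of "e i + k"] b A col_mult2[of _ n n "block i k" n b]
      by (metis block_carrier col_zero le_add1 poly_mat_carrier)
    then show "col (block i k) b = col (0\<^sub>m n n) b"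
      using kill[of "col (block i k) b"] b by (simp add: col_carrier_vec[OF b block_carrier])
  qed (simp_all add: carrier_matD[OF block_carrier])
  then show "\<forall>k. block i k = 0\<^sub>m n n" by blast
qed

text \<open>For \<open>\<phi> i k = \<Phi>\<^sub>k (x i)\<close> the values of the next three polynomials at \<open>A\<close> are \<open>f(A)\<close>, its
  semisimple part and its nilpotent part.  The coefficients \<open>\<phi>\<close> are arbitrary, so that polynomials
  and power series are treated at once.\<close>

definition taylor_poly :: "('i \<Rightarrow> nat \<Rightarrow> 'b) \<Rightarrow> 'b poly" where
  "taylor_poly \<phi> = (\<Sum>i\<in>I. \<Sum>k<e i. smult (\<phi> i k) ([:- x i, 1:] ^ k * C i))"

definition diagonal_poly :: "('i \<Rightarrow> nat \<Rightarrow> 'b) \<Rightarrow> 'b poly" where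
  "diagonal_poly \<phi> = (\<Sum>i\<in>I. smult (\<phi> i 0) (C i))"

definition nilpotent_poly :: "('i \<Rightarrow> nat \<Rightarrow> 'b) \<Rightarrow> 'b poly" where
  "nilpotent_poly \<phi> = (\<Sum>i\<in>I. \<Sum>k=1..e i. smult (\<phi> i k) ([:- x i, 1:] ^ k * C i))"

lemma taylor_poly_mat_index:
  "a < n \<Longrightarrow> b < n \<Longrightarrow>
    poly_mat (taylor_poly \<phi>) A $$ (a, b) = (\<Sum>i\<in>I. \<Sum>k<e i. \<phi> i k * block i k $$ (a, b))"
  using A by (simp add: taylor_poly_def poly_mat_sum[OF A] poly_mat_smult[OF A] block_def)

text \<open>The sum in the nilpotent part runs up to \<open>e i\<close> instead of \<open>e i - 1\<close>; its last block
  vanishes.\<close>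

lemma taylor_poly_mat_split:
  "poly_mat (taylor_poly \<phi>) A = poly_mat (diagonal_poly \<phi>) A + poly_mat (nilpotent_poly \<phi>) A"
proof (rule eq_matI)
  fix a b assume "a < dim_row (poly_mat (diagonal_poly \<phi>) A + poly_mat (nilpotent_poly \<phi>) A)"
    "b < dim_col (poly_mat (diagonal_poly \<phi>) A + poly_mat (nilpotent_poly \<phi>) A)"
  then have ab: "a < n" "b < n" using A by auto
  have "(\<Sum>k<e i. \<phi> i k * block i k $$ (a, b)) =
      \<phi> i 0 * block i 0 $$ (a, b) + (\<Sum>k=1..e i. \<phi> i k * block i k $$ (a, b))" if i: "i \<in> I" for i
  proof -
    have "(\<Sum>k<e i. \<phi> i k * block i k $$ (a, b)) = (\<Sum>k\<in>{0..e i}. \<phi> i k * block i k $$ (a, b))"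
      using block_eq_0[OF i] ab by (intro sum.mono_neutral_left) auto
    then show ?thesis by (simp add: sum.atLeast_Suc_atMost)
  qed
  then have "(\<Sum>i\<in>I. \<Sum>k<e i. \<phi> i k * block i k $$ (a, b)) =
      (\<Sum>i\<in>I. \<phi> i 0 * block i 0 $$ (a, b)) + (\<Sum>i\<in>I. \<Sum>k=1..e i. \<phi> i k * block i k $$ (a, b))"
    by (simp add: sum.distrib)
  then show "poly_mat (taylor_poly \<phi>) A $$ (a, b) =
      (poly_mat (diagonal_poly \<phi>) A + poly_mat (nilpotent_poly \<phi>) A) $$ (a, b)"
    using ab A taylor_poly_mat_index[OF ab]
    by (simp add: diagonal_poly_def nilpotent_poly_def poly_mat_sum[OF A] poly_mat_smult[OF A] block_def)
qed (use A in auto)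

text \<open>Modulo the annihilator the \<open>C i\<close> are orthogonal idempotents, so the polynomial acts on the
  image of \<open>C i\<close> as the scalar \<open>\<phi> i 0\<close>.\<close>

lemma diagonalizable_diagonal_poly: "diagonalizable (poly_mat (diagonal_poly \<phi>) A)"
proof (rule diagonalizable_if_projections[OF _ fin, where E = "\<lambda>i. poly_mat (C i) A"])
  show "mat_sum n I (\<lambda>i. poly_mat (C i) A) = 1\<^sub>m n"
    using A by (simp add: poly_mat_sum[OF A, symmetric] C_sum)
  fix i assume i: "i \<in> I"
  have "annihilator dvd C i * diagonal_poly \<phi> - smult (\<phi> i 0) (C i)"
  proof -
    have "C i * diagonal_poly \<phi> - smult (\<phi> i 0) (C i) =
        (\<Sum>j\<in>I. smult (\<phi> j 0) (C i * C j) - smult (\<phi> i 0) (C i * C j))"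
      by (simp add: diagonal_poly_def sum_distrib_left sum_subtractf)
        (simp add: smult_sum2[symmetric] sum_distrib_left[symmetric] C_sum)
    moreover have "annihilator dvd smult (\<phi> j 0) (C i * C j) - smult (\<phi> i 0) (C i * C j)"
      if "j \<in> I" for j
      using annihilator_dvd_C_mult[OF i that] by (cases "i = j") (auto intro!: dvd_diff dvd_smult)
    ultimately show ?thesis by (auto intro: dvd_sum)
  qed
  then show "poly_mat (C i) A * poly_mat (diagonal_poly \<phi>) A = \<phi> i 0 \<cdot>\<^sub>m poly_mat (C i) A"
    by (simp add: poly_mat_mult[OF A, symmetric] poly_mat_smult[OF A, symmetric] poly_mat_cong)
qed (use A in auto)

text \<open>Each \<open>t - x i\<close> divides every summand of the polynomial: the summands of index \<open>i\<close> by
  their explicit factor, the others through \<open>C j\<close>.  Hence a power of it is a multiple of the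
  annihilating product.\<close>

lemma nilpotent_nilpotent_poly: "nilpotent_mat (poly_mat (nilpotent_poly \<phi>) A)"
proof -
  have "[:- x i, 1:] dvd nilpotent_poly \<phi>" if i: "i \<in> I" for i
    unfolding nilpotent_poly_def
  proof (intro dvd_sum dvd_smult)
    fix j k assume j: "j \<in> I" and k: "k \<in> {1..e j}"
    show "[:- x i, 1:] dvd [:- x j, 1:] ^ k * C j"
    proof (cases "i = j")
      case True
      then show ?thesis using k by (auto intro!: dvd_mult2 dvd_power)
    next
      case False
      have "[:- x i, 1:] dvd [:- x i, 1:] ^ e i" using e_pos[OF i] by (intro dvd_power) auto
      then show ?thesis using factor_dvd_C[OF i j False] by (blast intro: dvd_mult dvd_trans)
    qed
  qed
  then have "annihilator dvd (\<Prod>i\<in>I. nilpotent_poly \<phi> ^ e i)"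
    unfolding annihilator_def by (intro prod_dvd_prod dvd_power_same)
  then have "annihilator dvd nilpotent_poly \<phi> ^ (\<Sum>i\<in>I. e i)"
    by (simp add: power_sum)
  from poly_mat_annihilator[OF this] show ?thesis
    using A unfolding nilpotent_mat_def by (auto simp: poly_mat_power)
qed

end

lemma jordan_chevalley_spectral:
  assumes F: "F \<in> carrier_mat n n" and "spectral_resolution A n I x e C"
    and eq: "map_mat to_ac F = poly_mat (spectral_resolution.taylor_poly I x e C \<phi>) A"
  shows "jordan_chevalley F (poly_mat (spectral_resolution.diagonal_poly I C \<phi>) A)
    (poly_mat (spectral_resolution.nilpotent_poly I x e C \<phi>) A)"
proof -
  interpret spectral_resolution A n I x e C by fact
  show ?thesis
    using F A diagonalizable_diagonal_poly nilpotent_nilpotent_poly eq taylor_poly_mat_split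
    by (auto simp: jordan_chevalley_def poly_mat_commute[OF A])
qed

section \<open>Eigenvectors over the splitting field\<close>

context
  fixes S :: "'a::field alg_closure set"
begin

lemma adjoin_base: "to_ac c \<in> adjoin S" and adjoin_generator: "x \<in> S \<Longrightarrow> x \<in> adjoin S"
  by (auto simp: adjoin_def intro: generate_field.incl)

lemma adjoin_add: "x \<in> adjoin S \<Longrightarrow> y \<in> adjoin S \<Longrightarrow> x + y \<in> adjoin S"
  using generate_field.eng_add[of x ring_of_type_algebra _ y]
  by (auto simp: adjoin_def ring_of_type_algebra_def)

lemma adjoin_mult: "x \<in> adjoin S \<Longrightarrow> y \<in> adjoin S \<Longrightarrow> x * y \<in> adjoin S"
  using generate_field.eng_mult[of x ring_of_type_algebra _ y]
  by (auto simp: adjoin_def ring_of_type_algebra_def)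

lemma adjoin_0: "0 \<in> adjoin S" and adjoin_1: "1 \<in> adjoin S"
  using adjoin_base[of 0] adjoin_base[of 1] by simp_all

lemma adjoin_uminus: "x \<in> adjoin S \<Longrightarrow> - x \<in> adjoin S"
  using adjoin_mult[OF adjoin_base[of "- 1"], of x] by simp

lemma adjoin_inverse:
  assumes x: "x \<in> adjoin S"
  shows "inverse x \<in> adjoin S"
proof (cases "x = 0")
  case False
  interpret F: field "ring_of_type_algebra :: 'a alg_closure ring" by blast
  have "inv\<^bsub>ring_of_type_algebra\<^esub> x = inverse x"
    using False by (intro F.comm_inv_char) (auto simp: ring_of_type_algebra_def)
  then show ?thesis
    using generate_field.m_inv[of x ring_of_type_algebra] x False
    by (auto simp: adjoin_def ring_of_type_algebra_def)
qed (use adjoin_0 in auto)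

lemma adjoin_divide: "x \<in> adjoin S \<Longrightarrow> y \<in> adjoin S \<Longrightarrow> x / y \<in> adjoin S"
  by (simp add: field_class.field_divide_inverse adjoin_mult adjoin_inverse)

lemma adjoin_sum: "(\<And>i. i \<in> I \<Longrightarrow> f i \<in> adjoin S) \<Longrightarrow> sum f I \<in> adjoin S"
  by (induction I rule: infinite_finite_induct) (auto intro: adjoin_0 adjoin_add)

lemma adjoin_power: "x \<in> adjoin S \<Longrightarrow> x ^ k \<in> adjoin S"
  by (induction k) (auto intro: adjoin_1 adjoin_mult)

lemma adjoin_coeff_mult:
  assumes "\<And>k. coeff p k \<in> adjoin S" "\<And>k. coeff q k \<in> adjoin S"
  shows "coeff (p * q) k \<in> adjoin S"
  unfolding coeff_mult by (intro adjoin_sum adjoin_mult assms)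

lemma adjoin_coeff_linear_power:
  assumes "x \<in> adjoin S"
  shows "coeff ([:- x, 1:] ^ m) k \<in> adjoin S"
proof (induction m arbitrary: k)
  case 0
  then show ?case by (simp add: adjoin_0 adjoin_1)
next
  case (Suc m)
  have "coeff [:- x, 1:] k \<in> adjoin S" for k
    using assms by (auto simp: coeff_pCons adjoin_0 adjoin_1 adjoin_uminus split: nat.split)
  then show ?case using Suc.IH by (simp only: power_Suc) (intro adjoin_coeff_mult)
qed

lemma adjoin_coeff_prod:
  assumes "\<And>i k. i \<in> I \<Longrightarrow> coeff (q i) k \<in> adjoin S"
  shows "coeff (\<Prod>i\<in>I. q i) k \<in> adjoin S"
  using assms
proof (induction I arbitrary: k rule: infinite_finite_induct)
  case (insert i I)
  then have "coeff (q i * (\<Prod>i\<in>I. q i)) k \<in> adjoin S" by (intro adjoin_coeff_mult) auto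
  then show ?case using insert.hyps by simp
qed (simp_all add: adjoin_0 adjoin_1)

lemma adjoin_poly_mat:
  assumes A: "A \<in> carrier_mat n n" and Ae: "\<And>a b. a < n \<Longrightarrow> b < n \<Longrightarrow> A $$ (a, b) \<in> adjoin S"
    and q: "\<And>k. coeff q k \<in> adjoin S" and ab: "a < n" "b < n"
  shows "poly_mat q A $$ (a, b) \<in> adjoin S"
proof -
  have "(A ^\<^sub>m k) $$ (a, b) \<in> adjoin S" if "a < n" "b < n" for a b k
    using that
  proof (induction k arbitrary: b)
    case 0
    then show ?case using A by (simp add: adjoin_0 adjoin_1)
  next
    case (Suc k)
    have "(A ^\<^sub>m Suc k) $$ (a, b) = (\<Sum>i = 0..<n. (A ^\<^sub>m k) $$ (a, i) * A $$ (i, b))"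
      using A Suc.prems by (simp add: scalar_prod_def)
    then show ?case using Suc Ae by (auto intro!: adjoin_sum adjoin_mult)
  qed
  then show ?thesis
    using ab q unfolding poly_mat_index[OF A ab lessI] by (intro adjoin_sum adjoin_mult) auto
qed

text \<open>Write the annihilating product as \<open>(t - y) ^ s * h\<close> with \<open>h y \<noteq> 0\<close>.  The last nonzero
  matrix among the \<open>(A - y) ^ k * h(A)\<close> has its columns in the eigenspace of \<open>y\<close>, and its
  entries are polynomial expressions in elements of the subfield.\<close>

lemma eigenvector_in_adjoin:
  assumes A: "A \<in> carrier_mat n n" and Ae: "\<And>a b. a < n \<Longrightarrow> b < n \<Longrightarrow> A $$ (a, b) \<in> adjoin S"
    and fin: "finite I" and x: "\<And>i. i \<in> I \<Longrightarrow> x i \<in> adjoin S"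
    and p: "poly_mat (\<Prod>i\<in>I. [:- x i, 1:] ^ e i) A = 0\<^sub>m n n"
    and ev: "eigenvalue A y"
  obtains u b where "u \<in> carrier_vec n" "A *\<^sub>v u = y \<cdot>\<^sub>v u" "b < n" "vec_index u b \<noteq> 0"
    "\<And>a. a < n \<Longrightarrow> vec_index u a \<in> adjoin S"
proof -
  define J where "J = {i \<in> I. x i = y}"
  define s where "s = (\<Sum>i\<in>J. e i)"
  define h where "h = (\<Prod>i\<in>I - J. [:- x i, 1:] ^ e i)"
  define W where "W k = poly_mat ([:- y, 1:] ^ k * h) A" for k
  have "(\<Prod>i\<in>I. [:- x i, 1:] ^ e i) = (\<Prod>i\<in>I - J. [:- x i, 1:] ^ e i) * (\<Prod>i\<in>J. [:- x i, 1:] ^ e i)"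
    using fin by (intro prod.subset_diff) (auto simp: J_def)
  also have "(\<Prod>i\<in>J. [:- x i, 1:] ^ e i) = [:- y, 1:] ^ s"
    by (simp add: J_def s_def power_sum)
  finally have Ws: "W s = 0\<^sub>m n n" using p by (simp add: W_def h_def mult.commute)
  have hy: "poly h y \<noteq> 0" using fin by (auto simp: h_def poly_prod J_def)
  obtain z where z: "z \<in> carrier_vec n" "z \<noteq> 0\<^sub>v n" "A *\<^sub>v z = y \<cdot>\<^sub>v z"
    using ev A by (auto simp: eigenvalue_def eigenvector_def)
  have "W 0 \<noteq> 0\<^sub>m n n"
  proof
    assume "W 0 = 0\<^sub>m n n"
    then have "poly h y \<cdot>\<^sub>v z = 0\<^sub>v n"
      using poly_mat_eigenvector[OF A z(1,3), of h] zero_mat_mult_vec[OF z(1), of n] by (simp add: W_def)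
    then have "vec_index (poly h y \<cdot>\<^sub>v z) a = 0" if "a < n" for a using that by simp
    then have "z = 0\<^sub>v n" using hy z(1) by (intro eq_vecI) auto
    then show False using z(2) by simp
  qed
  then obtain k where k: "W k \<noteq> 0\<^sub>m n n" "W (Suc k) = 0\<^sub>m n n"
    using Ws by (induction s) auto
  have Wc: "W k \<in> carrier_mat n n" using A by (simp add: W_def)
  obtain a b where ab: "a < n" "b < n" "W k $$ (a, b) \<noteq> 0"
  proof -
    have "\<exists>a<n. \<exists>b<n. W k $$ (a, b) \<noteq> 0"
    proof (rule ccontr)
      assume "\<not> ?thesis"
      then have "W k = 0\<^sub>m n n" using Wc by (intro eq_matI) auto
      then show False using k(1) by simp
    qed
    then show ?thesis using that by blast
  qed
  define u where "u = col (W k) b"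
  have u: "u \<in> carrier_vec n" using Wc ab by (auto simp: u_def)
  have "poly_mat [:- y, 1:] A * W k = 0\<^sub>m n n"
    using k(2) by (simp add: W_def poly_mat_mult[OF A, symmetric] mult.assoc[symmetric] power_Suc[symmetric]
        del: power_Suc mult_pCons_left mult_pCons_right)
  then have "poly_mat [:- y, 1:] A *\<^sub>v u = 0\<^sub>v n"
    using col_mult2[OF _ Wc ab(2), of "poly_mat [:- y, 1:] A" n] A ab(2) by (simp add: u_def)
  moreover have "poly_mat [:- y, 1:] A = char_matrix A y"
    unfolding poly_mat_linear[OF A] char_matrix_def using A by (intro eq_matI) auto
  moreover have ua: "vec_index u a \<noteq> 0" using ab Wc by (simp add: u_def)
  moreover have "u \<noteq> 0\<^sub>v n" using ua ab(1) by auto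
  ultimately have "A *\<^sub>v u = y \<cdot>\<^sub>v u"
    using u eigenvector_char_matrix[OF A, of u y] by (simp add: eigenvector_def)
  moreover have "vec_index u c \<in> adjoin S" if c: "c < n" for c
  proof -
    have "poly (\<Prod>i\<in>I. [:- x i, 1:] ^ e i) y = 0" by (rule eigenvalue_is_root[OF A p ev])
    then obtain i where "i \<in> I" "y = x i" using fin by (auto simp: poly_prod)
    then have "y \<in> adjoin S" using x by simp
    then have "coeff ([:- y, 1:] ^ k * h) m \<in> adjoin S" for m
      unfolding h_def
      by (intro adjoin_coeff_mult adjoin_coeff_linear_power adjoin_coeff_prod x) auto
    then have "W k $$ (c, b) \<in> adjoin S"
      unfolding W_def using A Ae c ab(2) by (intro adjoin_poly_mat)
    then show ?thesis using c ab Wc by (simp add: u_def)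
  qed
  ultimately show ?thesis using that[OF u _ ab(1) ua] by blast
qed

end

section \<open>Absolute values\<close>

text \<open>Convergence expressed by a real null sequence, which brings the limit theorems for real
  sequences to bear on an arbitrary valued field.\<close>

definition av_tendsto :: "('b::field \<Rightarrow> real) \<Rightarrow> (nat \<Rightarrow> 'b) \<Rightarrow> 'b \<Rightarrow> bool" where
  "av_tendsto v f l \<longleftrightarrow> (\<lambda>N. v (f N - l)) \<longlonglongrightarrow> 0"

context
  fixes v :: "'b::field \<Rightarrow> real"
  assumes v: "absolute_value v"
begin

lemma av_nonneg: "0 \<le> v x"
  and av_eq_0_iff: "v x = 0 \<longleftrightarrow> x = 0"
  and av_triangle: "v (x + y) \<le> v x + v y"
  and av_mult: "v (x * y) = v x * v y"
  using v by (auto simp: absolute_value_def)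

lemma av_0: "v 0 = 0"
  by (simp add: av_eq_0_iff)

lemma av_1: "v 1 = 1"
  using av_mult[of 1 1] av_eq_0_iff[of 1] by simp

lemma av_minus: "v (- x) = v x"
proof -
  have "v (- 1) * v (- 1) = 1" using av_mult[of "- 1" "- 1"] av_1 by simp
  then have "v (- 1) = 1" using av_nonneg[of "- 1"] by (auto simp: square_eq_1_iff)
  then show ?thesis using av_mult[of "- 1" x] by simp
qed

lemma av_diff_commute: "v (x - y) = v (y - x)"
  using av_minus[of "x - y"] by simp

lemma av_power: "v (x ^ k) = v x ^ k"
  by (induction k) (auto simp: av_1 av_mult)

lemma av_sum: "v (sum f I) \<le> (\<Sum>i\<in>I. v (f i))"
  by (induction I rule: infinite_finite_induct)
    (auto simp: av_0 intro: order_trans[OF av_triangle])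

lemma av_of_nat: "v (of_nat k) \<le> real k"
  using av_sum[of "\<lambda>_. 1" "{..<k}"] by (simp add: av_1)

lemma av_metric: "Metric_space UNIV (\<lambda>x y. v (x - y))"
proof
  fix x y z :: 'b
  show "v (x - z) \<le> v (x - y) + v (y - z)"
    using av_triangle[of "x - y" "y - z"] by simp
qed (auto simp: av_nonneg av_eq_0_iff av_diff_commute)

lemma limitin_av_topology: "limitin (av_topology v) f l sequentially \<longleftrightarrow> av_tendsto v f l"
  unfolding av_topology_def av_tendsto_def Metric_space.limitin_metric[OF av_metric]
  by (auto simp: tendsto_iff av_nonneg)

lemma av_tendsto_const: "av_tendsto v (\<lambda>_. c) c"
  by (simp add: av_tendsto_def av_0)

lemma av_tendsto_add:
  assumes "av_tendsto v f l" "av_tendsto v g m"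
  shows "av_tendsto v (\<lambda>N. f N + g N) (l + m)"
proof -
  have "v (f N + g N - (l + m)) \<le> v (f N - l) + v (g N - m)" for N
    using av_triangle[of "f N - l" "g N - m"] by (simp add: algebra_simps)
  then have "\<forall>\<^sub>F N in sequentially. norm (v (f N + g N - (l + m))) \<le> v (f N - l) + v (g N - m)"
    by (simp add: av_nonneg)
  moreover have "(\<lambda>N. v (f N - l) + v (g N - m)) \<longlonglongrightarrow> 0"
    using tendsto_add[OF assms[unfolded av_tendsto_def]] by simp
  ultimately show ?thesis
    unfolding av_tendsto_def by (rule Lim_null_comparison)
qed

lemma av_tendsto_mult_right:
  assumes "av_tendsto v f l"
  shows "av_tendsto v (\<lambda>N. f N * c) (l * c)"
proof -
  have "v (f N * c - l * c) = v (f N - l) * v c" for N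
    by (simp add: left_diff_distrib[symmetric] av_mult)
  then show ?thesis
    using tendsto_mult_right[OF assms[unfolded av_tendsto_def], of "v c"] by (simp add: av_tendsto_def)
qed

lemma av_tendsto_sum:
  "(\<And>i. i \<in> I \<Longrightarrow> av_tendsto v (f i) (l i)) \<Longrightarrow>
    av_tendsto v (\<lambda>N. \<Sum>i\<in>I. f i N) (\<Sum>i\<in>I. l i)"
proof (induction I rule: infinite_finite_induct)
  case (insert i I)
  then have "av_tendsto v (\<lambda>N. f i N + (\<Sum>i\<in>I. f i N)) (l i + (\<Sum>i\<in>I. l i))"
    by (intro av_tendsto_add) auto
  with insert.hyps show ?case by simp
qed (simp_all add: av_tendsto_const)

lemma av_tendsto_unique:
  assumes "av_tendsto v f l" "av_tendsto v f m"
  shows "l = m"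
proof -
  have "(\<lambda>N. v (f N - l) + v (f N - m)) \<longlonglongrightarrow> 0"
    using tendsto_add[OF assms[unfolded av_tendsto_def]] by simp
  moreover have "v (l - m) \<le> v (f N - l) + v (f N - m)" for N
    using av_triangle[of "l - f N" "f N - m"] by (simp add: av_diff_commute[of l])
  ultimately have "v (l - m) \<le> 0" by (intro LIMSEQ_le_const) auto
  then show ?thesis using av_nonneg[of "l - m"] av_eq_0_iff[of "l - m"] by simp
qed

end

text \<open>The comparison test.\<close>

lemma complete_valued_field_sums:
  assumes c: "complete_valued_field v" and le: "\<And>l. v (a l) \<le> g l" and g: "summable g"
  shows "\<exists>L. av_tendsto v (\<lambda>N. \<Sum>l<N. a l) L"
proof -
  have v: "absolute_value v" using c by (simp add: complete_valued_field_def)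
  interpret Metric_space UNIV "\<lambda>x y. v (x - y)" by (rule av_metric[OF v])
  have dist_le: "v ((\<Sum>l<i. a l) - (\<Sum>l<j. a l)) \<le> norm ((\<Sum>l<i. g l) - (\<Sum>l<j. g l))"
    if "i \<le> j" for i j
  proof -
    have "v ((\<Sum>l<i. a l) - (\<Sum>l<j. a l)) = v ((\<Sum>l<j. a l) - (\<Sum>l<i. a l))"
      by (rule av_diff_commute[OF v])
    also have "(\<Sum>l<j. a l) - (\<Sum>l<i. a l) = (\<Sum>l=i..<j. a l)"
      using sum_diff_nat_ivl[of 0 i j a] that by (simp add: atLeast0LessThan)
    also have "v \<dots> \<le> (\<Sum>l=i..<j. v (a l))" by (rule av_sum[OF v])
    also have "\<dots> \<le> (\<Sum>l=i..<j. g l)" by (intro sum_mono le)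
    also have "\<dots> = (\<Sum>l<j. g l) - (\<Sum>l<i. g l)"
      using sum_diff_nat_ivl[of 0 i j g] that by (simp add: atLeast0LessThan)
    finally show ?thesis by simp
  qed
  have dist: "v ((\<Sum>l<i. a l) - (\<Sum>l<j. a l)) \<le> norm ((\<Sum>l<i. g l) - (\<Sum>l<j. g l))" for i j
    using dist_le[of i j] dist_le[of j i] av_diff_commute[OF v] norm_minus_commute
    by (metis nat_le_linear)
  have "Cauchy (\<lambda>N. \<Sum>l<N. g l)"
    using g by (simp add: summable_iff_convergent convergent_Cauchy)
  then have "MCauchy (\<lambda>N. \<Sum>l<N. a l)"
    unfolding MCauchy_def Cauchy_def dist_norm using dist by (meson le_less_trans subset_UNIV)
  then have "\<exists>L. limitin (av_topology v) (\<lambda>N. \<Sum>l<N. a l) L sequentially"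
    using c by (auto simp: complete_valued_field_def mcomplete_def av_topology_def)
  then show ?thesis by (simp add: limitin_av_topology[OF v])
qed

section \<open>Power series inside the disc of convergence\<close>

text \<open>Multiplied by \<open>d ^ k\<close>, the left-hand side is one term of the binomial expansion of
  \<open>(x + d) ^ l\<close>.  So a factor \<open>l choose k\<close> is absorbed by enlarging the radius.\<close>

lemma choose_mult_power_le:
  fixes x d :: real
  assumes "0 \<le> x" "0 < d"
  shows "real (l choose k) * x ^ (l - k) \<le> (x + d) ^ l / d ^ k"
proof (cases "k \<le> l")
  case True
  have "real (l choose k) * d ^ k * x ^ (l - k) \<le> (\<Sum>j\<le>l. real (l choose j) * d ^ j * x ^ (l - j))"
    using True assms by (intro member_le_sum) auto
  also have "\<dots> = (x + d) ^ l" by (simp add: binomial_ring[symmetric] add.commute)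
  finally show ?thesis using assms by (simp add: field_simps)
qed (use assms in \<open>simp add: binomial_eq_0\<close>)

text \<open>Any \<open>s\<close> beyond the spectral radius works: in the resolution of \<open>A ^ l\<close> the only growth
  besides that of the powers of the eigenvalues comes from binomial coefficients, and the gap
  \<open>s - \<rho>\<close> absorbs those.\<close>

lemma (in spectral_resolution) pow_mat_growth:
  assumes w: "absolute_value w" and rad: "\<And>y. eigenvalue A y \<Longrightarrow> w y \<le> \<rho>"
    and \<rho>: "0 \<le> \<rho>" "\<rho> < s" and ab: "a < n" "b < n"
  obtains K where "0 \<le> K" "\<And>l. w ((A ^\<^sub>m l) $$ (a, b)) \<le> K * s ^ l"
proof
  define K where "K = (\<Sum>i\<in>I. \<Sum>k<e i. w (block i k $$ (a, b)) / (s - \<rho>) ^ k)"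
  show "0 \<le> K" unfolding K_def using \<rho> by (intro sum_nonneg divide_nonneg_nonneg) (auto simp: av_nonneg[OF w])
  fix l
  have term_le: "w (of_nat (l choose k) * x i ^ (l - k) * block i k $$ (a, b)) \<le>
      w (block i k $$ (a, b)) / (s - \<rho>) ^ k * s ^ l" if i: "i \<in> I" for i k
  proof (cases "eigenvalue A (x i)")
    case True
    have "w (of_nat (l choose k) * x i ^ (l - k)) \<le> real (l choose k) * \<rho> ^ (l - k)"
      unfolding av_mult[OF w] av_power[OF w]
      using rad[OF True] by (intro mult_mono power_mono av_of_nat[OF w] av_nonneg[OF w] zero_le_power) auto
    also have "\<dots> \<le> s ^ l / (s - \<rho>) ^ k"
      using choose_mult_power_le[of \<rho> "s - \<rho>" l k] \<rho> by simp
    finally have "w (of_nat (l choose k) * x i ^ (l - k)) * w (block i k $$ (a, b)) \<le>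
        s ^ l / (s - \<rho>) ^ k * w (block i k $$ (a, b))"
      by (intro mult_right_mono av_nonneg[OF w])
    then show ?thesis by (simp add: av_mult[OF w] mult.commute)
  next
    case False
    then have "block i k = 0\<^sub>m n n" using block_0_or_eigenvalue[OF i] by blast
    then show ?thesis using ab by (simp add: av_0[OF w])
  qed
  have "w ((A ^\<^sub>m l) $$ (a, b)) \<le>
      (\<Sum>i\<in>I. w (\<Sum>k<e i. of_nat (l choose k) * x i ^ (l - k) * block i k $$ (a, b)))"
    unfolding pow_mat_resolution[OF ab] by (rule av_sum[OF w])
  also have "\<dots> \<le> (\<Sum>i\<in>I. \<Sum>k<e i. w (of_nat (l choose k) * x i ^ (l - k) * block i k $$ (a, b)))"
    by (rule sum_mono) (rule av_sum[OF w])
  also have "\<dots> \<le> (\<Sum>i\<in>I. \<Sum>k<e i. w (block i k $$ (a, b)) / (s - \<rho>) ^ k * s ^ l)"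
    by (rule sum_mono, rule sum_mono) (rule term_le)
  also have "\<dots> = K * s ^ l" by (simp add: K_def sum_distrib_right)
  finally show "w ((A ^\<^sub>m l) $$ (a, b)) \<le> K * s ^ l" .
qed

lemma Phi_term_below: "l < k \<Longrightarrow> Phi_term c k y l = 0"
  by (simp add: Phi_term_def binomial_eq_0)

lemma sum_Phi_term: "(\<Sum>l=k..<N. Phi_term c k y l) = (\<Sum>l<N. Phi_term c k y l)"
  by (rule sum.mono_neutral_left) (auto simp: Phi_term_below)

text \<open>The matrix has entries in the base field, while its eigenvalues, and with them the
  resolution, live in the algebraic closure.\<close>

locale base_change_resolution = spectral_resolution "map_mat to_ac M" n I x e C
  for M :: "'a::field mat" and n :: nat and I :: "'i set" and x e C +
  assumes M: "M \<in> carrier_mat n n"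
begin

lemma to_ac_pow_index: "a < n \<Longrightarrow> b < n \<Longrightarrow> (map_mat to_ac M ^\<^sub>m l) $$ (a, b) = to_ac ((M ^\<^sub>m l) $$ (a, b))"
  using M by (simp add: map_mat_to_ac_pow[OF M, symmetric])

lemma partial_sum_resolution:
  assumes "a < n" "b < n"
  shows "to_ac (\<Sum>l<N. c l * (M ^\<^sub>m l) $$ (a, b)) =
    (\<Sum>i\<in>I. \<Sum>k<e i. (\<Sum>l<N. Phi_term c k (x i) l) * block i k $$ (a, b))"
proof -
  have "to_ac (\<Sum>l<N. c l * (M ^\<^sub>m l) $$ (a, b)) =
      (\<Sum>l<N. to_ac (c l) * (map_mat to_ac M ^\<^sub>m l) $$ (a, b))"
    using assms by (simp add: to_ac_sum to_ac_pow_index)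
  also have "\<dots> = (\<Sum>l<N. \<Sum>i\<in>I. \<Sum>k<e i. Phi_term c k (x i) l * block i k $$ (a, b))"
    unfolding pow_mat_resolution[OF assms]
    by (simp add: sum_distrib_left Phi_term_def mult.assoc mult.left_commute)
  also have "\<dots> = (\<Sum>i\<in>I. \<Sum>l<N. \<Sum>k<e i. Phi_term c k (x i) l * block i k $$ (a, b))"
    by (rule sum.swap)
  also have "\<dots> = (\<Sum>i\<in>I. \<Sum>k<e i. \<Sum>l<N. Phi_term c k (x i) l * block i k $$ (a, b))"
    by (rule sum.cong[OF refl]) (rule sum.swap)
  finally show ?thesis by (simp add: sum_distrib_right)
qed

text \<open>Convergence takes place in the complete base field: by the growth estimate for the entries of
  \<open>M ^ l\<close>, the terms are dominated by a geometric series.\<close>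

lemma derivative_series_converges:
  assumes v: "complete_valued_field v" and w: "extends_absolute_value v w"
    and rad: "\<And>y. eigenvalue (map_mat to_ac M) y \<Longrightarrow> w y \<le> \<rho>" and \<rho>: "0 \<le> \<rho>" "\<rho> < t"
    and bound: "\<And>l. v (c l) * t ^ l \<le> K0" and ab: "a < n" "b < n"
  shows "\<exists>L. av_tendsto v (\<lambda>N. \<Sum>l<N. of_nat (l choose k) * c l * (M ^\<^sub>m (l - k)) $$ (a, b)) L"
proof -
  have av: "absolute_value v" using v by (simp add: complete_valued_field_def)
  have aw: "absolute_value w" and vw: "v y = w (to_ac y)" for y
    using w by (auto simp: extends_absolute_value_def)
  (* The radius is enlarged twice, by d for the growth of the powers of M and by d for the
     binomial coefficient, and still stays below t. *)
  define d where "d = (t - \<rho>) / 3"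
  have d: "0 < d" "\<rho> < \<rho> + d" "\<rho> + d + d < t" using \<rho> by (auto simp: d_def field_simps)
  have t: "0 < t" using \<rho> by simp
  obtain K where K: "0 \<le> K" "\<And>l. w ((map_mat to_ac M ^\<^sub>m l) $$ (a, b)) \<le> K * (\<rho> + d) ^ l"
    using pow_mat_growth[OF aw rad \<rho>(1) d(2) ab] by blast
  define g where "g l = K0 * K / d ^ k * ((\<rho> + d + d) / t) ^ l" for l
  show ?thesis
  proof (rule complete_valued_field_sums[OF v])
    show "summable g"
      unfolding g_def using d \<rho> t by (intro summable_mult summable_geometric) auto
    fix l
    have "v (of_nat (l choose k) * c l * (M ^\<^sub>m (l - k)) $$ (a, b)) =
        v (c l) * (v (of_nat (l choose k)) * w ((map_mat to_ac M ^\<^sub>m (l - k)) $$ (a, b)))"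
      using ab by (simp add: av_mult[OF av] vw[symmetric] to_ac_pow_index)
    also have "\<dots> \<le> v (c l) * (real (l choose k) * (K * (\<rho> + d) ^ (l - k)))"
      by (intro mult_left_mono mult_mono av_of_nat[OF av] K av_nonneg[OF av] av_nonneg[OF aw]) auto
    also have "\<dots> = v (c l) * K * (real (l choose k) * (\<rho> + d) ^ (l - k))" by simp
    also have "\<dots> \<le> v (c l) * K * ((\<rho> + d + d) ^ l / d ^ k)"
      using d \<rho> K(1) by (intro mult_left_mono choose_mult_power_le mult_nonneg_nonneg av_nonneg[OF av]) auto
    also have "\<dots> = v (c l) * t ^ l * (K / d ^ k * ((\<rho> + d + d) / t) ^ l)"
      using t by (simp add: power_divide)
    also have "\<dots> \<le> K0 * (K / d ^ k * ((\<rho> + d + d) / t) ^ l)"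
      using bound[of l] d \<rho> K(1) t
      by (intro mult_right_mono mult_nonneg_nonneg divide_nonneg_nonneg zero_le_power) auto
    finally show "v (of_nat (l choose k) * c l * (M ^\<^sub>m (l - k)) $$ (a, b)) \<le> g l"
      by (simp add: g_def)
  qed
qed

text \<open>The derivative series of matrices acts on an eigenvector as the scalar series, so a nonzero
  coordinate of the eigenvector transports convergence from the matrix entries to the scalar, and
  the limit lies in any intermediate field over which the eigenvector is defined.\<close>

lemma scalar_series_converges:
  assumes w: "absolute_value w" and vw: "\<And>y. w (to_ac y) = v y"
    and ev: "eigenvalue (map_mat to_ac M) y" and roots: "\<And>i. i \<in> I \<Longrightarrow> x i \<in> adjoin S"
    and H: "\<And>a b. a < n \<Longrightarrow> b < n \<Longrightarrow>
      av_tendsto v (\<lambda>N. \<Sum>l<N. of_nat (l choose k) * c l * (M ^\<^sub>m (l - k)) $$ (a, b)) (H a b)"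
  shows "\<exists>L \<in> adjoin S. av_tendsto w (\<lambda>N. \<Sum>l<N. Phi_term c k y l) L"
proof -
  have "map_mat to_ac M $$ (a, b) \<in> adjoin S" if "a < n" "b < n" for a b
    using that M by (simp add: adjoin_base)
  then obtain u a where u: "u \<in> carrier_vec n" "map_mat to_ac M *\<^sub>v u = y \<cdot>\<^sub>v u"
    and a: "a < n" "vec_index u a \<noteq> 0" and uS: "\<And>a. a < n \<Longrightarrow> vec_index u a \<in> adjoin S"
    using eigenvector_in_adjoin[OF A _ fin roots annihilates ev] by blast
  define h where "h N b = (\<Sum>l<N. of_nat (l choose k) * c l * (M ^\<^sub>m (l - k)) $$ (a, b))" for N b
  have pow_u: "(\<Sum>b<n. to_ac ((M ^\<^sub>m j) $$ (a, b)) * vec_index u b) = y ^ j * vec_index u a" for j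
  proof -
    have "map_mat to_ac M ^\<^sub>m j *\<^sub>v u = y ^ j \<cdot>\<^sub>v u"
      using poly_mat_eigenvector[OF A u, of "[:0, 1:] ^ j"] by (simp add: poly_mat_X_power[OF A])
    then have "vec_index (map_mat to_ac M ^\<^sub>m j *\<^sub>v u) a = y ^ j * vec_index u a"
      using a(1) u(1) by simp
    moreover have "vec_index (map_mat to_ac M ^\<^sub>m j *\<^sub>v u) a =
        (\<Sum>b<n. to_ac ((M ^\<^sub>m j) $$ (a, b)) * vec_index u b)"
      using a(1) u(1) M by (simp add: scalar_prod_def to_ac_pow_index atLeast0LessThan)
    ultimately show ?thesis by simp
  qed
  have partial: "(\<Sum>b<n. to_ac (h N b) * (vec_index u b / vec_index u a)) = (\<Sum>l<N. Phi_term c k y l)" for N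
  proof -
    have "(\<Sum>b<n. to_ac (h N b) * (vec_index u b / vec_index u a)) =
        (\<Sum>b<n. \<Sum>l<N. to_ac (of_nat (l choose k) * c l) *
          (to_ac ((M ^\<^sub>m (l - k)) $$ (a, b)) * vec_index u b) / vec_index u a)"
      by (simp add: h_def to_ac_sum sum_distrib_right sum_divide_distrib mult.assoc)
    also have "\<dots> = (\<Sum>l<N. \<Sum>b<n. to_ac (of_nat (l choose k) * c l) *
          (to_ac ((M ^\<^sub>m (l - k)) $$ (a, b)) * vec_index u b) / vec_index u a)"
      by (rule sum.swap)
    also have "\<dots> = (\<Sum>l<N. to_ac (of_nat (l choose k) * c l) *
          (\<Sum>b<n. to_ac ((M ^\<^sub>m (l - k)) $$ (a, b)) * vec_index u b) / vec_index u a)"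
      by (simp add: sum_distrib_left sum_divide_distrib)
    also have "\<dots> = (\<Sum>l<N. Phi_term c k y l)"
      using a(2) by (simp add: pow_u Phi_term_def mult.assoc)
    finally show ?thesis .
  qed
  define L where "L = (\<Sum>b<n. to_ac (H a b) * (vec_index u b / vec_index u a))"
  have "av_tendsto w (\<lambda>N. \<Sum>b<n. to_ac (h N b) * (vec_index u b / vec_index u a)) L"
    unfolding L_def
  proof (intro av_tendsto_sum[OF w] av_tendsto_mult_right[OF w])
    fix b assume "b \<in> {..<n}"
    then show "av_tendsto w (\<lambda>N. to_ac (h N b)) (to_ac (H a b))"
      using H[of a b] a(1) by (simp add: av_tendsto_def h_def vw to_ac_diff[symmetric] del: to_ac_diff)
  qed
  then have "av_tendsto w (\<lambda>N. \<Sum>l<N. Phi_term c k y l) L" by (simp only: partial)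
  moreover have "L \<in> adjoin S"
    unfolding L_def using uS a by (intro adjoin_sum adjoin_mult adjoin_divide adjoin_base) auto
  ultimately show ?thesis by blast
qed

text \<open>Both sides of the formula for the partial sums converge.  A root \<open>x i\<close> that is not an
  eigenvalue contributes zero blocks.\<close>

lemma limit_resolution:
  assumes w: "absolute_value w" and vw: "\<And>y. w (to_ac y) = v y"
    and H: "av_tendsto v (\<lambda>N. \<Sum>l<N. c l * (M ^\<^sub>m l) $$ (a, b)) h"
    and \<Phi>: "\<And>y k. eigenvalue (map_mat to_ac M) y \<Longrightarrow> av_tendsto w (\<lambda>N. \<Sum>l<N. Phi_term c k y l) (\<Phi> k y)"
    and ab: "a < n" "b < n"
  shows "to_ac h = poly_mat (taylor_poly (\<lambda>i k. \<Phi> k (x i))) (map_mat to_ac M) $$ (a, b)"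
proof (rule av_tendsto_unique[OF w])
  show "av_tendsto w (\<lambda>N. to_ac (\<Sum>l<N. c l * (M ^\<^sub>m l) $$ (a, b))) (to_ac h)"
    using H by (simp add: av_tendsto_def vw to_ac_diff[symmetric] del: to_ac_diff)
  show "av_tendsto w (\<lambda>N. to_ac (\<Sum>l<N. c l * (M ^\<^sub>m l) $$ (a, b)))
      (poly_mat (taylor_poly (\<lambda>i k. \<Phi> k (x i))) (map_mat to_ac M) $$ (a, b))"
    unfolding partial_sum_resolution[OF ab] taylor_poly_mat_index[OF ab]
  proof (rule av_tendsto_sum[OF w], rule av_tendsto_sum[OF w])
    fix i k assume i: "i \<in> I"
    show "av_tendsto w (\<lambda>N. (\<Sum>l<N. Phi_term c k (x i) l) * block i k $$ (a, b))
        (\<Phi> k (x i) * block i k $$ (a, b))"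
    proof (cases "eigenvalue (map_mat to_ac M) (x i)")
      case True
      then show ?thesis by (intro av_tendsto_mult_right[OF w] \<Phi>)
    next
      case False
      then have "block i k = 0\<^sub>m n n" using block_0_or_eigenvalue[OF i] by blast
      then show ?thesis using ab by (simp add: av_tendsto_const[OF w])
    qed
  qed
qed

end

section \<open>The values of polynomials and power series\<close>

theorem proposition3p2:
  fixes M :: "'a::field mat" and n r :: nat
    and p :: "'a poly" and m :: "nat \<Rightarrow> 'a poly" and \<mu> \<rho> \<eta> :: "nat \<Rightarrow> nat"
    and lam :: "nat \<Rightarrow> nat \<Rightarrow> 'a alg_closure"
    and B G C :: "nat \<Rightarrow> nat \<Rightarrow> 'a alg_closure poly"
  assumes n: "0 < n" and M: "M \<in> carrier_mat n n"
    and minimal_polynomial: "is_minimal_polynomial M p"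
    and factorization: "p = (\<Prod>i=1..r. m i ^ \<mu> i)"
    and factors: "\<And>i. i \<in> {1..r} \<Longrightarrow> irreducible (m i) \<and> lead_coeff (m i) = 1 \<and> 0 < \<mu> i"
    and distinct: "inj_on m {1..r}"
    and order: "eigenvalue M 0 \<Longrightarrow> m r = [:0, 1:]"
    and roots: "\<And>i. i \<in> {1..r} \<Longrightarrow>
      bij_betw (lam i) {1..\<rho> i} {x. poly (map_poly to_ac (m i)) x = 0}"
    and splitting: "map_poly to_ac p = (\<Prod>i=1..r. \<Prod>j=1..\<rho> i. [:- lam i j, 1:] ^ \<eta> i)"
    and eta: "\<And>i. i \<in> {1..r} \<Longrightarrow> \<mu> i \<le> \<eta> i"
    and G: "\<And>i j. i \<in> {1..r} \<Longrightarrow> j \<in> {1..\<rho> i} \<Longrightarrow>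
      G i j = map_poly to_ac p div [:- lam i j, 1:] ^ \<eta> i"
    and B: "\<And>i j. i \<in> {1..r} \<Longrightarrow> j \<in> {1..\<rho> i} \<Longrightarrow>
      degree (B i j) < \<eta> i \<and> (\<forall>k. coeff (B i j) k \<in> adjoin (lam i ` {1..\<rho> i}))"
    and bezout: "(\<Sum>i=1..r. \<Sum>j=1..\<rho> i. B i j * G i j) = 1"
    and C: "\<And>i j. i \<in> {1..r} \<Longrightarrow> j \<in> {1..\<rho> i} \<Longrightarrow> C i j = B i j * G i j"
  shows
    "let M' = map_mat to_ac M;
         L = (\<lambda>i j. M' - lam i j \<cdot>\<^sub>m 1\<^sub>m n);
         CM = (\<lambda>i j. poly_mat (C i j) M');
         claim = (\<lambda>(fM :: 'a mat) (\<Phi> :: nat \<Rightarrow> 'a alg_closure \<Rightarrow> 'a alg_closure).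
           fM \<in> carrier_mat n n \<and>
           (\<forall>x. eigenvalue M' x \<longrightarrow>
             x \<in> splitting_field p \<and> (\<forall>k. \<Phi> k x \<in> splitting_field p)) \<and>
           map_mat to_ac fM =
             mat_sum n {1..r} (\<lambda>i. mat_sum n {1..\<rho> i} (\<lambda>j.
               mat_sum n {0..\<eta> i - 1} (\<lambda>k. \<Phi> k (lam i j) \<cdot>\<^sub>m L i j ^\<^sub>m k) * CM i j)) \<and>
           semisimple_part fM =
             mat_sum n {1..r} (\<lambda>i. mat_sum n {1..\<rho> i} (\<lambda>j. \<Phi> 0 (lam i j) \<cdot>\<^sub>m CM i j)) \<and>
           nilpotent_part fM =
             mat_sum n {1..r} (\<lambda>i. mat_sum n {1..\<rho> i} (\<lambda>j.
               mat_sum n {1..\<eta> i} (\<lambda>k. \<Phi> k (lam i j) \<cdot>\<^sub>m (L i j ^\<^sub>m k * CM i j)))))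
     in (\<forall>f :: 'a poly.
           claim (poly_mat f M) (\<lambda>k x. \<Sum>l=k..degree f. Phi_term (coeff f) k x l)) \<and>
        (\<forall>(f :: 'a fps) (v :: 'a \<Rightarrow> real) (w :: 'a alg_closure \<Rightarrow> real).
           complete_valued_field v \<and> extends_absolute_value v w \<and>
           ereal (av_spectral_radius w M) < radius_of_convergence v f \<longrightarrow>
           (\<exists>fM \<Phi>.
             mat_limit v n (\<lambda>N. mat_sum n {..<N} (\<lambda>l. fps_nth f l \<cdot>\<^sub>m M ^\<^sub>m l)) fM \<and>
             (\<forall>x k. eigenvalue M' x \<longrightarrow>
               limitin (av_topology w) (\<lambda>N. \<Sum>l=k..<N. Phi_term (fps_nth f) k x l) (\<Phi> k x)
                 sequentially) \<and>
             claim fM \<Phi>))"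
proof -
  define A where "A = map_mat to_ac M"
  define I where "I = (SIGMA i:{1..r}. {1..\<rho> i})"
  define x where "x = (\<lambda>(i, j). lam i j)"
  define e where "e = (\<lambda>(i, j :: nat). \<eta> i)"
  define D where "D = (\<lambda>(i, j). C i j)"
  define P where "P = map_poly to_ac p"
  have A_carrier: "A \<in> carrier_mat n n" using M by (simp add: A_def)
  have finI: "finite I" by (simp add: I_def)
  have P: "P = (\<Prod>i\<in>I. [:- x i, 1:] ^ e i)"
    unfolding P_def splitting I_def x_def e_def by (simp add: prod.Sigma case_prod_unfold)
  have "poly_mat p M = 0\<^sub>m n n"
    using minimal_polynomial M by (simp add: is_minimal_polynomial_def)
  moreover have "map_mat to_ac (0\<^sub>m n n :: 'a mat) = 0\<^sub>m n n" by (intro eq_matI) auto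
  ultimately have PA: "poly_mat P A = 0\<^sub>m n n"
    using map_mat_poly_mat[OF M, of p] by (simp add: P_def A_def)
  have e_pos: "0 < e i" if "i \<in> I" for i
    using that factors eta by (fastforce simp: I_def e_def)
  interpret base_change_resolution M n I x e D
  proof
    show "map_mat to_ac M \<in> carrier_mat n n" using A_carrier by (simp add: A_def)
    show "finite I" "M \<in> carrier_mat n n" by (fact finI M)+
    show "0 < e i" if "i \<in> I" for i using that by (rule e_pos)
    show "poly_mat (\<Prod>i\<in>I. [:- x i, 1:] ^ e i) (map_mat to_ac M) = 0\<^sub>m n n"
      using PA by (simp only: P A_def)
    show "(\<Prod>j\<in>I - {i}. [:- x j, 1:] ^ e j) dvd D i" if i: "i \<in> I" for i
    proof -
      obtain a b where ab: "i = (a, b)" "a \<in> {1..r}" "b \<in> {1..\<rho> a}" using i by (auto simp: I_def)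
      have "P div [:- x i, 1:] ^ e i = (\<Prod>j\<in>I - {i}. [:- x j, 1:] ^ e j)"
        unfolding P prod.remove[OF finI i] by (rule nonzero_mult_div_cancel_left) simp
      then have "D i = B a b * (\<Prod>j\<in>I - {i}. [:- x j, 1:] ^ e j)"
        using ab C[OF ab(2,3)] G[OF ab(2,3)] by (simp add: D_def P_def x_def e_def)
      then show ?thesis by simp
    qed
    have "(\<Sum>i\<in>I. D i) = (\<Sum>i=1..r. \<Sum>j=1..\<rho> i. C i j)"
      unfolding I_def D_def by (simp add: sum.Sigma case_prod_unfold)
    also have "\<dots> = 1" using bezout by (simp add: C)
    finally show "(\<Sum>i\<in>I. D i) = 1" .
  qed
  let ?\<phi> = "\<lambda>\<Phi>. (\<lambda>i k. \<Phi> k (x i))"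
  have L: "A - lam i j \<cdot>\<^sub>m 1\<^sub>m n = poly_mat [:- lam i j, 1:] A" for i j
    by (simp add: poly_mat_linear[OF A_carrier])
  note to_poly_mat = L poly_mat_power[OF A_carrier, symmetric] poly_mat_smult[OF A_carrier, symmetric]
    poly_mat_mult[OF A_carrier, symmetric] poly_mat_sum[OF A_carrier, symmetric]

  (* The three matrices of the statement are values of the polynomials of the resolution. *)

  have sum_over_I: "sum F I = (\<Sum>i=1..r. \<Sum>j=1..\<rho> i. F (i, j))"
    for F :: "nat \<times> nat \<Rightarrow> 'a alg_closure poly"
    by (simp add: I_def sum.Sigma case_prod_unfold)
  have T: "mat_sum n {1..r} (\<lambda>i. mat_sum n {1..\<rho> i} (\<lambda>j. mat_sum n {0..\<eta> i - 1}
        (\<lambda>k. \<Phi> k (lam i j) \<cdot>\<^sub>m (A - lam i j \<cdot>\<^sub>m 1\<^sub>m n) ^\<^sub>m k) * poly_mat (C i j) A)) =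
      poly_mat (taylor_poly (?\<phi> \<Phi>)) A" for \<Phi>
  proof -
    have range: "{..<\<eta> i} = {0..\<eta> i - 1}" if "i \<in> {1..r}" for i
      using factors[OF that] eta[OF that] by auto
    have "taylor_poly (?\<phi> \<Phi>) = (\<Sum>i=1..r. \<Sum>j=1..\<rho> i. \<Sum>k<\<eta> i.
        smult (\<Phi> k (lam i j)) ([:- lam i j, 1:] ^ k * C i j))"
      unfolding taylor_poly_def sum_over_I by (simp add: x_def e_def D_def)
    also have "\<dots> = (\<Sum>i=1..r. \<Sum>j=1..\<rho> i.
        (\<Sum>k=0..\<eta> i - 1. smult (\<Phi> k (lam i j)) ([:- lam i j, 1:] ^ k)) * C i j)"
      by (rule sum.cong[OF refl], rule sum.cong[OF refl]) (simp only: range sum_distrib_right mult_smult_left)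
    finally show ?thesis by (simp only: to_poly_mat)
  qed
  have S: "mat_sum n {1..r} (\<lambda>i. mat_sum n {1..\<rho> i}
        (\<lambda>j. \<Phi> 0 (lam i j) \<cdot>\<^sub>m poly_mat (C i j) A)) = poly_mat (diagonal_poly (?\<phi> \<Phi>)) A"
    for \<Phi> :: "nat \<Rightarrow> 'a alg_closure \<Rightarrow> 'a alg_closure"
  proof -
    have "diagonal_poly (?\<phi> \<Phi>) = (\<Sum>i=1..r. \<Sum>j=1..\<rho> i. smult (\<Phi> 0 (lam i j)) (C i j))"
      unfolding diagonal_poly_def sum_over_I by (simp add: x_def e_def D_def)
    then show ?thesis by (simp only: to_poly_mat)
  qed
  have N: "mat_sum n {1..r} (\<lambda>i. mat_sum n {1..\<rho> i} (\<lambda>j. mat_sum n {1..\<eta> i}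
        (\<lambda>k. \<Phi> k (lam i j) \<cdot>\<^sub>m ((A - lam i j \<cdot>\<^sub>m 1\<^sub>m n) ^\<^sub>m k * poly_mat (C i j) A)))) =
      poly_mat (nilpotent_poly (?\<phi> \<Phi>)) A" for \<Phi>
  proof -
    have "nilpotent_poly (?\<phi> \<Phi>) = (\<Sum>i=1..r. \<Sum>j=1..\<rho> i. \<Sum>k=1..\<eta> i.
        smult (\<Phi> k (lam i j)) ([:- lam i j, 1:] ^ k * C i j))"
      unfolding nilpotent_poly_def sum_over_I by (simp add: x_def e_def D_def)
    then show ?thesis by (simp only: to_poly_mat)
  qed

  have ev_splitting: "y \<in> splitting_field p" if "eigenvalue A y" for y
    using eigenvalue_is_root[OF A_carrier PA that] unfolding splitting_field_def P_def
    by (intro adjoin_generator) simp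
  have root_splitting: "x i \<in> splitting_field p" if i: "i \<in> I" for i
  proof -
    have "poly P (x i) = 0" unfolding P using i finI e_pos[OF i] by (auto simp: poly_prod)
    then show ?thesis
      unfolding splitting_field_def P_def by (intro adjoin_generator) simp
  qed

  define claim where "claim fM \<Phi> \<longleftrightarrow> fM \<in> carrier_mat n n \<and>
      (\<forall>y. eigenvalue A y \<longrightarrow> y \<in> splitting_field p \<and> (\<forall>k. \<Phi> k y \<in> splitting_field p)) \<and>
      map_mat to_ac fM = mat_sum n {1..r} (\<lambda>i. mat_sum n {1..\<rho> i} (\<lambda>j. mat_sum n {0..\<eta> i - 1}
        (\<lambda>k. \<Phi> k (lam i j) \<cdot>\<^sub>m (A - lam i j \<cdot>\<^sub>m 1\<^sub>m n) ^\<^sub>m k) * poly_mat (C i j) A)) \<and>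
      semisimple_part fM = mat_sum n {1..r} (\<lambda>i. mat_sum n {1..\<rho> i}
        (\<lambda>j. \<Phi> 0 (lam i j) \<cdot>\<^sub>m poly_mat (C i j) A)) \<and>
      nilpotent_part fM = mat_sum n {1..r} (\<lambda>i. mat_sum n {1..\<rho> i} (\<lambda>j. mat_sum n {1..\<eta> i}
        (\<lambda>k. \<Phi> k (lam i j) \<cdot>\<^sub>m ((A - lam i j \<cdot>\<^sub>m 1\<^sub>m n) ^\<^sub>m k * poly_mat (C i j) A))))"
    for fM :: "'a mat" and \<Phi> :: "nat \<Rightarrow> 'a alg_closure \<Rightarrow> 'a alg_closure"
  have claimI: "claim fM \<Phi>"
    if fM: "fM \<in> carrier_mat n n"
      and \<Phi>: "\<And>y k. eigenvalue A y \<Longrightarrow> \<Phi> k y \<in> splitting_field p"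
      and eq: "\<And>a b. a < n \<Longrightarrow> b < n \<Longrightarrow>
        to_ac (fM $$ (a, b)) = poly_mat (taylor_poly (?\<phi> \<Phi>)) A $$ (a, b)"
    for fM \<Phi>
  proof -
    have "map_mat to_ac fM = poly_mat (taylor_poly (?\<phi> \<Phi>)) A"
      using fM A_carrier eq by (intro eq_matI) auto
    moreover from this have "jordan_chevalley fM (poly_mat (diagonal_poly (?\<phi> \<Phi>)) A)
        (poly_mat (nilpotent_poly (?\<phi> \<Phi>)) A)"
      unfolding A_def by (intro jordan_chevalley_spectral[OF fM spectral_resolution_axioms])
    ultimately show ?thesis
      unfolding claim_def T S N using fM \<Phi> ev_splitting semisimple_nilpotent_part_eqI[OF fM] by blast
  qed

  have polynomial: "claim (poly_mat f M) (\<lambda>k y. \<Sum>l=k..degree f. Phi_term (coeff f) k y l)"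
    for f :: "'a poly"
  proof (rule claimI)
    show "poly_mat f M \<in> carrier_mat n n" using M by simp
  next
    fix y k assume "eigenvalue A y"
    then have "y \<in> splitting_field p" by (rule ev_splitting)
    then show "(\<Sum>l=k..degree f. Phi_term (coeff f) k y l) \<in> splitting_field p"
      unfolding Phi_term_def splitting_field_def
      by (intro adjoin_sum adjoin_mult adjoin_base adjoin_power)
  next
    fix a b assume ab: "a < n" "b < n"
    have "(\<Sum>l=k..degree f. Phi_term (coeff f) k y l) =
        (\<Sum>l<Suc (degree f). Phi_term (coeff f) k y l)" for k y
      unfolding sum_Phi_term[symmetric] by (simp only: atLeastLessThanSuc_atLeastAtMost)
    then show "to_ac (poly_mat f M $$ (a, b)) =
        poly_mat (taylor_poly (\<lambda>i k. \<Sum>l=k..degree f. Phi_term (coeff f) k (x i) l)) A $$ (a, b)"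
      unfolding poly_mat_index[OF M ab lessI] A_def taylor_poly_mat_index[OF ab]
        partial_sum_resolution[OF ab] by simp
  qed

  have power_series: "\<exists>fM \<Phi>.
      mat_limit v n (\<lambda>N. mat_sum n {..<N} (\<lambda>l. fps_nth f l \<cdot>\<^sub>m M ^\<^sub>m l)) fM \<and>
      (\<forall>y k. eigenvalue A y \<longrightarrow>
        limitin (av_topology w) (\<lambda>N. \<Sum>l=k..<N. Phi_term (fps_nth f) k y l) (\<Phi> k y) sequentially) \<and>
      claim fM \<Phi>"
    if v: "complete_valued_field v" and w: "extends_absolute_value v w"
      and radius: "ereal (av_spectral_radius w M) < radius_of_convergence v f"
    for f :: "'a fps" and v w
  proof -
    have av: "absolute_value v" using v by (simp add: complete_valued_field_def)
    have aw: "absolute_value w" and vw: "\<And>y. w (to_ac y) = v y"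
      using w by (auto simp: extends_absolute_value_def)
    define E where "E = {y. eigenvalue A y}"
    define \<sigma> where "\<sigma> = av_spectral_radius w M"
    have \<sigma>: "\<sigma> = Max (w ` E)" by (simp add: \<sigma>_def av_spectral_radius_def E_def A_def)
    have "P \<noteq> 0" using finI by (auto simp: P)
    then have "finite E"
      using eigenvalue_is_root[OF A_carrier PA] unfolding E_def
      by (intro finite_subset[OF _ poly_roots_finite]) auto
    then have rad: "w y \<le> \<sigma>" if "eigenvalue A y" for y
      using that unfolding \<sigma> by (intro Max_ge) (auto simp: E_def)
    (* The maximum defining the spectral radius ranges over a nonempty set. *)
    have "degree (char_poly A) = n" using degree_monic_char_poly[OF A_carrier] by simp
    then obtain y0 where "poly (char_poly A) y0 = 0"
      using n alg_closed_imp_poly_has_root[of "char_poly A"] by auto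
    then have "eigenvalue A y0" by (simp add: eigenvalue_root_char_poly[OF A_carrier])
    then have \<sigma>_nonneg: "0 \<le> \<sigma>" using rad[of y0] av_nonneg[OF aw, of y0] by linarith
    obtain t where t: "\<sigma> < t" "bdd_above (range (\<lambda>l. v (fps_nth f l) * t ^ l))"
      using radius unfolding radius_of_convergence_def \<sigma>_def[symmetric] less_SUP_iff by auto
    then obtain K0 where K0: "\<And>l. v (fps_nth f l) * t ^ l \<le> K0" by (auto simp: bdd_above_def)
    define H where "H k a b = (SOME L. av_tendsto v
        (\<lambda>N. \<Sum>l<N. of_nat (l choose k) * fps_nth f l * (M ^\<^sub>m (l - k)) $$ (a, b)) L)" for k a b
    have H: "av_tendsto v
        (\<lambda>N. \<Sum>l<N. of_nat (l choose k) * fps_nth f l * (M ^\<^sub>m (l - k)) $$ (a, b)) (H k a b)"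
      if "a < n" "b < n" for k a b
      unfolding H_def
      by (rule someI_ex, rule derivative_series_converges[OF v w _ \<sigma>_nonneg t(1) K0 that])
        (use rad in \<open>simp add: A_def\<close>)
    define \<Phi> where "\<Phi> k y = (SOME L. L \<in> splitting_field p \<and>
        av_tendsto w (\<lambda>N. \<Sum>l<N. Phi_term (fps_nth f) k y l) L)" for k y
    have \<Phi>_spec: "\<Phi> k y \<in> splitting_field p \<and>
        av_tendsto w (\<lambda>N. \<Sum>l<N. Phi_term (fps_nth f) k y l) (\<Phi> k y)"
      if y: "eigenvalue A y" for k y
    proof -
      have "\<exists>L\<in>splitting_field p. av_tendsto w (\<lambda>N. \<Sum>l<N. Phi_term (fps_nth f) k y l) L"
        using root_splitting y unfolding splitting_field_def A_def
        by (intro scalar_series_converges[OF aw vw, where H = "H k"] H)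
      then have "\<exists>L. L \<in> splitting_field p \<and>
          av_tendsto w (\<lambda>N. \<Sum>l<N. Phi_term (fps_nth f) k y l) L" by blast
      then show ?thesis unfolding \<Phi>_def by (rule someI_ex)
    qed
    then have \<Phi>: "\<Phi> k y \<in> splitting_field p"
      and \<Phi>_lim: "av_tendsto w (\<lambda>N. \<Sum>l<N. Phi_term (fps_nth f) k y l) (\<Phi> k y)"
      if "eigenvalue A y" for k y using that by blast+
    define fM where "fM = mat n n (\<lambda>(a, b). H 0 a b)"
    have lim: "av_tendsto v (\<lambda>N. \<Sum>l<N. fps_nth f l * (M ^\<^sub>m l) $$ (a, b)) (fM $$ (a, b))"
      if "a < n" "b < n" for a b
      using H[OF that, of 0] that by (simp add: fM_def)
    have "claim fM \<Phi>"
    proof (rule claimI)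
      show "fM \<in> carrier_mat n n" by (simp add: fM_def)
      show "\<Phi> k y \<in> splitting_field p" if "eigenvalue A y" for y k using that by (rule \<Phi>)
      show "to_ac (fM $$ (a, b)) = poly_mat (taylor_poly (?\<phi> \<Phi>)) A $$ (a, b)"
        if ab: "a < n" "b < n" for a b
        unfolding A_def using limit_resolution[OF aw vw lim[OF ab] \<Phi>_lim ab] by (simp add: A_def)
    qed
    moreover have "mat_limit v n (\<lambda>N. mat_sum n {..<N} (\<lambda>l. fps_nth f l \<cdot>\<^sub>m M ^\<^sub>m l)) fM"
      using lim M by (simp add: mat_limit_def limitin_av_topology[OF av])
    moreover have "\<forall>y k. eigenvalue A y \<longrightarrow>
        limitin (av_topology w) (\<lambda>N. \<Sum>l=k..<N. Phi_term (fps_nth f) k y l) (\<Phi> k y) sequentially"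
      using \<Phi>_lim by (simp add: limitin_av_topology[OF aw] sum_Phi_term)
    ultimately show ?thesis by blast
  qed

  show ?thesis
    using polynomial power_series unfolding claim_def A_def Let_def by blast
qed

end
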